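(* Let $\mathfrak{g}$ be a finite-dimensional two-step nilpotent Lie superalgebra over $\mathbb{F}$, let $\mathcal{V}_{\mathfrak{g}}$ be any ($\mathbb{Z}_2$-graded) complement space of $[\mathfrak{g},\mathfrak{g}]$ in $\mathfrak{g}$, and let $\mathcal{V}_{\mathfrak{g}}^{*}$ be the dual space of $\mathcal{V}_{\mathfrak{g}}$. Suppose that for every integer $k\ge 1$ the following two conditions are satisfied: (1) $[\mathfrak{g},\mathfrak{g}]\otimes\bigwedge^{k}\mathcal{V}_{\mathfrak{g}}^{*}\subseteq \mathrm{Im}\,\mathrm{d}$; (2) for any $f\in[\mathfrak{g},\mathfrak{g}]^{*}$ and $g\in\bigwedge^{k}\mathcal{V}_{\mathfrak{g}}^{*}$, if $\mathrm{d}(f)\wedge g=0$, then $f=0$ or $g=0$. Then the cup product on the adjoint cohomology $\mathrm{H}^{\bullet}(\mathfrak{g},\mathfrak{g})$ is trivial, i.e. the cup product of any two classes in $\mathrm{H}^{\bullet}(\mathfrak{g},\mathfrak{g})$ is zero.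
   Context: $\mathbb{F}$ is an algebraically closed field of characteristic zero; all vector spaces and algebras are over $\mathbb{F}$. A Lie superalgebra is a $\mathbb{Z}_2$-graded algebra whose bracket satisfies skew-supersymmetry and the super Jacobi identity. Put $\mathfrak{g}^0=\mathfrak{g}$, $\mathfrak{g}^{i+1}=[\mathfrak{g},\mathfrak{g}^i]$; $\mathfrak{g}$ is two-step nilpotent if $\mathfrak{g}^1\neq0$ and $\mathfrak{g}^2=0$. $|v|$ denotes the $\mathbb{Z}_2$-degree, and $\|\cdot\|$ the $\mathbb{Z}$-degree of cochains. For a superspace $V$, $\bigwedge^{\bullet}V$ is the super-exterior algebra: the quotient of the tensor superalgebra by the ideal generated by all $x\otimes y+(-1)^{|x||y|}y\otimes x$ ($x,y\in V$ homogeneous). Differential: let $\{x_i\}_{i\in I}$ be a homogeneous basis of $\mathfrak{g}$ ($I$ totally ordered), $\{x_i^*\}$ the dual basis, $[x_k,x_l]=\sum_i a_{kl}^i x_i$. On $\bigwedge^\bullet\mathfrak{g}^*$, $\mathrm{d}(x_i^* )=\sum_{k<l}(-1)^{|x_k||x_l|+1}a_{kl}^i x_k^*\wedge x_l^*+\frac12\sum_k a_{kk}^i (x_k^{*})^{2}$ and $\mathrm{d}(x\wedge y)=\mathrm{d}(x)\wedge y+(-1)^{\|x\|}x\wedge\mathrm{d}(y)$. For a $\mathfrak{g}$-module $M$, on $M\otimes\bigwedge^\bullet\mathfrak{g}^*$: $\mathrm{d}(m)=\sum_i(-1)^{|x_i||m|}(x_i\cdot m)\otimes x_i^*$ and $\mathrm{d}(m\otimes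 w)=\mathrm{d}(m)\wedge w+m\otimes\mathrm{d}(w)$. $\mathrm{H}^\bullet(\mathfrak{g},M)$ is the cohomology of this complex; the adjoint cohomology is $\mathrm{H}^\bullet(\mathfrak{g},\mathfrak{g})$, with $M=\mathfrak{g}$ the adjoint module. In (1), $\mathrm{Im}\,\mathrm{d}$ is the image of $\mathrm{d}$ on $\mathfrak{g}\otimes\bigwedge^\bullet\mathfrak{g}^*$; in (2), $\mathrm{d}$ is the differential of $\bigwedge^\bullet\mathfrak{g}^*$. Using $\mathfrak{g}=[\mathfrak{g},\mathfrak{g}]\oplus\mathcal{V}_{\mathfrak{g}}$, the duals $[\mathfrak{g},\mathfrak{g}]^*$ and $\mathcal{V}_{\mathfrak{g}}^*$ are regarded as subspaces of $\mathfrak{g}^*$ (functionals vanishing on the other summand). Cup product on $\mathfrak{g}\otimes\bigwedge^\bullet\mathfrak{g}^*$ (with respect to the bracket of $\mathfrak{g}$): the bilinear map given, for homogeneous $a,b\in\mathfrak{g}$ and $u,v\in\bigwedge^\bullet\mathfrak{g}^*$, by $(a\otimes u)\cup(b\otimes v)=(-1)^{|u||b|}[a,b]\otimes(u\wedge v)$. It satisfies $\mathrm{d}(f\cup g)=\mathrm{d}f\cup g+(-1)^{\|f\|}f\cup\mathrm{d}g$ and hence induces a product on $\mathrm{H}^\bullet(\mathfrak{g},\mathfrak{g})$. *)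

theory Defs
  imports
    "HOL-Computational_Algebra.Polynomial"
    "HOL-Library.Z2"
    "HOL-Library.Poly_Mapping"
    "HOL-Library.Function_Algebras"
    "HOL-Library.Set_Algebras"
begin

section \<open>Lie superalgebras\<close>

definition sg :: "bit \<Rightarrow> 'a::ring_1" where
  "sg p = (if p = 0 then 1 else - 1)"

record ('k, 'g) superalg =
  scl :: "'k \<Rightarrow> 'g \<Rightarrow> 'g"
  gr :: "bit \<Rightarrow> 'g set"
  brk :: "'g \<Rightarrow> 'g \<Rightarrow> 'g"

locale lie_superalgebra =
  fixes L :: "('k::field, 'g::ab_group_add) superalg"
  assumes vector_space: "vector_space (scl L)"
    and subspace_gr: "module.subspace (scl L) (gr L p)"
    and gr_inter: "gr L 0 \<inter> gr L 1 = {0}"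
    and gr_sum: "gr L 0 + gr L 1 = UNIV"
    and linear_right: "Vector_Spaces.linear (scl L) (scl L) (\<lambda>v. brk L u v)"
    and linear_left: "Vector_Spaces.linear (scl L) (scl L) (\<lambda>u. brk L u v)"
    and brk_gr: "u \<in> gr L p \<Longrightarrow> v \<in> gr L q \<Longrightarrow> brk L u v \<in> gr L (p + q)"
    and skew: "u \<in> gr L p \<Longrightarrow> v \<in> gr L q \<Longrightarrow> brk L u v = - scl L (sg (p * q)) (brk L v u)"
    and jacobi: "u \<in> gr L p \<Longrightarrow> v \<in> gr L q \<Longrightarrow>
      brk L u (brk L v w) = brk L (brk L u v) w + scl L (sg (p * q)) (brk L v (brk L u w))"

definition finite_dim :: "('k::field, 'g::ab_group_add) superalg \<Rightarrow> bool" where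
  "finite_dim L \<longleftrightarrow> (\<exists>B. finite B \<and> module.span (scl L) B = UNIV)"

primrec lower_central :: "('k::field, 'g::ab_group_add) superalg \<Rightarrow> nat \<Rightarrow> 'g set" where
  "lower_central L 0 = UNIV"
| "lower_central L (Suc i) = module.span (scl L) {brk L u v |u v. v \<in> lower_central L i}"

definition two_step_nilpotent :: "('k::field, 'g::ab_group_add) superalg \<Rightarrow> bool" where
  "two_step_nilpotent L \<longleftrightarrow> lower_central L 1 \<noteq> {0} \<and> lower_central L 2 = {0}"

abbreviation derived :: "('k::field, 'g::ab_group_add) superalg \<Rightarrow> 'g set" where
  "derived L \<equiv> lower_central L 1"

definition graded_complement ::
    "('k::field, 'g::ab_group_add) superalg \<Rightarrow> 'g set \<Rightarrow> 'g set \<Rightarrow> bool" where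
  "graded_complement L W V \<longleftrightarrow>
     module.subspace (scl L) V \<and> V = (V \<inter> gr L 0) + (V \<inter> gr L 1) \<and>
     W \<inter> V = {0} \<and> W + V = UNIV"

definition dual :: "('k::field, 'g::ab_group_add) superalg \<Rightarrow> ('g \<Rightarrow> 'k) set" where
  "dual L = {f. Vector_Spaces.linear (scl L) (*) f}"

definition dual_gr ::
    "('k::field, 'g::ab_group_add) superalg \<Rightarrow> bit \<Rightarrow> ('g \<Rightarrow> 'k) set" where
  "dual_gr L p = {f \<in> dual L. \<forall>v \<in> gr L (p + 1). f v = 0}"

text \<open>If \<open>\<gg> = U \<oplus> W\<close>, the dual of \<open>U\<close> as a subspace of the dual of \<open>\<gg>\<close> is \<open>annihilator L W\<close>.\<close>

definition annihilator ::
    "('k::field, 'g::ab_group_add) superalg \<Rightarrow> 'g set \<Rightarrow> ('g \<Rightarrow> 'k) set" where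
  "annihilator L W = {f \<in> dual L. \<forall>v \<in> W. f v = 0}"

definition homogeneous_basis ::
    "('k::field, 'g::ab_group_add) superalg \<Rightarrow> ('i \<Rightarrow> 'g) \<Rightarrow> bool" where
  "homogeneous_basis L x \<longleftrightarrow>
     inj x \<and> \<not> module.dependent (scl L) (range x) \<and> module.span (scl L) (range x) = UNIV \<and>
     (\<forall>i. \<exists>p. x i \<in> gr L p)"

definition par :: "('k, 'g) superalg \<Rightarrow> ('i \<Rightarrow> 'g) \<Rightarrow> 'i \<Rightarrow> bit" where
  "par L x i = (if x i \<in> gr L 0 then 0 else 1)"

definition coord :: "('k::field, 'g::ab_group_add) superalg \<Rightarrow> ('i \<Rightarrow> 'g) \<Rightarrow> 'g \<Rightarrow> 'i \<Rightarrow> 'k" where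
  "coord L x v i = module.representation (scl L) (range x) v (x i)"

section \<open>The tensor algebra and the super-exterior algebra of the dual\<close>

datatype 'i word = Word (letters: "'i list")

instantiation word :: (type) monoid_add
begin
definition "0 = Word []"
definition "v + w = Word (letters v @ letters w)"
instance
  by standard (simp_all add: zero_word_def plus_word_def)
end

text \<open>
  The monoid algebra of the free monoid on \<open>'i\<close> is the tensor algebra of the dual of \<open>\<gg>\<close>:
  the letter \<open>i\<close> stands for the element \<open>x\<^sub>i\<^sup>*\<close> of the basis dual to \<open>x\<close>, and a
  functional \<open>f\<close> is the element \<open>\<Sum>\<^sub>i f(x\<^sub>i) x\<^sub>i\<^sup>*\<close> (see \<open>covec\<close>).
\<close>

type_synonym ('i, 'k) tens = "'i word \<Rightarrow>\<^sub>0 'k"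

abbreviation gen :: "'i \<Rightarrow> ('i, 'k::ring_1) tens" where
  "gen i \<equiv> Poly_Mapping.single (Word [i]) 1"

definition smul :: "'k \<Rightarrow> ('i, 'k::ring_1) tens \<Rightarrow> ('i, 'k) tens" where
  "smul c t = Poly_Mapping.single 0 c * t"

definition covec ::
    "('i::finite \<Rightarrow> 'g) \<Rightarrow> ('g \<Rightarrow> 'k::ring_1) \<Rightarrow> ('i, 'k) tens" where
  "covec x f = (\<Sum>i\<in>UNIV. smul (f (x i)) (gen i))"

inductive_set two_sided_ideal :: "'a::ring_1 set \<Rightarrow> 'a set" for S where
  zero: "0 \<in> two_sided_ideal S"
| base: "s \<in> S \<Longrightarrow> s \<in> two_sided_ideal S"
| add: "r \<in> two_sided_ideal S \<Longrightarrow> s \<in> two_sided_ideal S \<Longrightarrow> r + s \<in> two_sided_ideal S"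
| left: "s \<in> two_sided_ideal S \<Longrightarrow> a * s \<in> two_sided_ideal S"
| right: "s \<in> two_sided_ideal S \<Longrightarrow> s * a \<in> two_sided_ideal S"

text \<open>
  The super-exterior algebra of the dual is the tensor algebra modulo \<open>ext_ideal L x\<close>. Its
  elements are handled through representatives in the tensor algebra: an equation \<open>s = t\<close> in
  the quotient reads \<open>s - t \<in> ext_ideal L x\<close>, and the wedge product is the class of \<open>s * t\<close>.
\<close>

definition ext_ideal ::
    "('k::field, 'g::ab_group_add) superalg \<Rightarrow> ('i::finite \<Rightarrow> 'g) \<Rightarrow> ('i, 'k) tens set" where
  "ext_ideal L x = two_sided_ideal
     {covec x f * covec x h + sg (p * q) * (covec x h * covec x f) |f h p q.
        f \<in> dual_gr L p \<and> h \<in> dual_gr L q}"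

text \<open>Representatives of the \<open>k\<close>-th exterior power of a subspace \<open>W\<close> of the dual.\<close>

definition ext_power ::
    "('i::finite \<Rightarrow> 'g) \<Rightarrow> ('g \<Rightarrow> 'k::field) set \<Rightarrow> nat \<Rightarrow> ('i, 'k) tens set" where
  "ext_power x W k =
     module.span smul {prod_list (map (covec x) fs) |fs. length fs = k \<and> set fs \<subseteq> W}"

definition par_word :: "('k, 'g) superalg \<Rightarrow> ('i \<Rightarrow> 'g) \<Rightarrow> 'i word \<Rightarrow> bit" where
  "par_word L x w = sum_list (map (par L x) (letters w))"

text \<open>The component of \<open>\<int>\<^sub>2\<close>-degree \<open>p\<close>.\<close>

definition par_part ::
    "('k::field, 'g) superalg \<Rightarrow> ('i \<Rightarrow> 'g) \<Rightarrow> bit \<Rightarrow> ('i, 'k) tens \<Rightarrow> ('i, 'k) tens" where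
  "par_part L x p t =
     (\<Sum>w | w \<in> Poly_Mapping.keys t \<and> par_word L x w = p. Poly_Mapping.single w (Poly_Mapping.lookup t w))"

definition diff_gen ::
    "('k::field, 'g::ab_group_add) superalg \<Rightarrow> ('i::{finite, linorder} \<Rightarrow> 'g) \<Rightarrow> 'i \<Rightarrow> ('i, 'k) tens" where
  "diff_gen L x i =
     (\<Sum>l\<in>UNIV. \<Sum>k | k < l.
        smul (sg (par L x k * par L x l + 1) * coord L x (brk L (x k) (x l)) i) (gen k * gen l)) +
     smul (1 / 2) (\<Sum>k\<in>UNIV. smul (coord L x (brk L (x k) (x k)) i) (gen k ^ 2))"

fun diff_word ::
    "('k::field, 'g::ab_group_add) superalg \<Rightarrow> ('i::{finite, linorder} \<Rightarrow> 'g) \<Rightarrow> 'i list \<Rightarrow> ('i, 'k) tens" where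
  "diff_word L x [] = 0"
| "diff_word L x (i # w) = diff_gen L x i * Poly_Mapping.single (Word w) 1 - gen i * diff_word L x w"

definition ext_diff ::
    "('k::field, 'g::ab_group_add) superalg \<Rightarrow> ('i::{finite, linorder} \<Rightarrow> 'g) \<Rightarrow> ('i, 'k) tens \<Rightarrow> ('i, 'k) tens" where
  "ext_diff L x t =
     (\<Sum>w\<in>Poly_Mapping.keys t. smul (Poly_Mapping.lookup t w) (diff_word L x (letters w)))"

section \<open>The adjoint cochain complex and its cohomology\<close>

text \<open>
  The tensor product of \<open>\<gg>\<close> with the tensor algebra is represented by functions on the index
  type, \<open>F\<close> standing for \<open>\<Sum>\<^sub>i x\<^sub>i \<otimes> F i\<close>. A cochain vanishes in \<open>\<gg> \<otimes> \<And>\<gg>\<^sup>*\<close> iff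
  it lies in \<open>null_cochains\<close>.
\<close>

type_synonym ('i, 'k) cochain = "'i \<Rightarrow> ('i, 'k) tens"

definition tensor ::
    "('k::field, 'g::ab_group_add) superalg \<Rightarrow> ('i \<Rightarrow> 'g) \<Rightarrow> 'g \<Rightarrow> ('i, 'k) tens \<Rightarrow> ('i, 'k) cochain" where
  "tensor L x m t = (\<lambda>i. smul (coord L x m i) t)"

definition null_cochains ::
    "('k::field, 'g::ab_group_add) superalg \<Rightarrow> ('i::finite \<Rightarrow> 'g) \<Rightarrow> ('i, 'k) cochain set" where
  "null_cochains L x = {F. \<forall>i. F i \<in> ext_ideal L x}"

definition cochain_diff ::
    "('k::field, 'g::ab_group_add) superalg \<Rightarrow> ('i::{finite, linorder} \<Rightarrow> 'g) \<Rightarrow>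
     ('i, 'k) cochain \<Rightarrow> ('i, 'k) cochain" where
  "cochain_diff L x F =
     (\<Sum>i\<in>UNIV.
        (\<Sum>j\<in>UNIV. tensor L x (brk L (x j) (x i)) (sg (par L x j * par L x i) * (gen j * F i))) +
        tensor L x (x i) (ext_diff L x (F i)))"

definition cup ::
    "('k::field, 'g::ab_group_add) superalg \<Rightarrow> ('i::finite \<Rightarrow> 'g) \<Rightarrow>
     ('i, 'k) cochain \<Rightarrow> ('i, 'k) cochain \<Rightarrow> ('i, 'k) cochain" where
  "cup L x F H =
     (\<Sum>i\<in>UNIV. \<Sum>j\<in>UNIV. \<Sum>p\<in>{0, 1}.
        tensor L x (brk L (x i) (x j)) (sg (p * par L x j) * (par_part L x p (F i) * H j)))"

definition cocycles ::
    "('k::field, 'g::ab_group_add) superalg \<Rightarrow> ('i::{finite, linorder} \<Rightarrow> 'g) \<Rightarrow> ('i, 'k) cochain set" where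
  "cocycles L x = {F. cochain_diff L x F \<in> null_cochains L x}"

text \<open>Representatives of the elements of the image of the differential.\<close>

definition coboundaries ::
    "('k::field, 'g::ab_group_add) superalg \<Rightarrow> ('i::{finite, linorder} \<Rightarrow> 'g) \<Rightarrow> ('i, 'k) cochain set" where
  "coboundaries L x = range (cochain_diff L x) + null_cochains L x"

definition cohomology ::
    "('k::field, 'g::ab_group_add) superalg \<Rightarrow> ('i::{finite, linorder} \<Rightarrow> 'g) \<Rightarrow> ('i, 'k) cochain set set" where
  "cohomology L x = {F +o coboundaries L x |F. F \<in> cocycles L x}"

definition cup_class ::
    "('k::field, 'g::ab_group_add) superalg \<Rightarrow> ('i::{finite, linorder} \<Rightarrow> 'g) \<Rightarrow>
     ('i, 'k) cochain set \<Rightarrow> ('i, 'k) cochain set \<Rightarrow> ('i, 'k) cochain set" where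
  "cup_class L x A B = (\<Union>F\<in>A. \<Union>H\<in>B. cup L x F H +o coboundaries L x)"

definition tensor_space ::
    "('k::field, 'g::ab_group_add) superalg \<Rightarrow> ('i \<Rightarrow> 'g) \<Rightarrow> 'g set \<Rightarrow> ('i, 'k) tens set \<Rightarrow> ('i, 'k) cochain set" where
  "tensor_space L x U T =
     module.span (\<lambda>c F i. smul c (F i)) {tensor L x m t |m t. m \<in> U \<and> t \<in> T}"

section \<open>The defining equations\<close>

text \<open>
  The recursions above satisfy the equations by which the differentials and the cup product are
  usually specified: \<open>ext_diff_gen\<close>, \<open>ext_diff_mult\<close>, \<open>cochain_diff_tensor\<close> and \<open>cup_tensor\<close>.
\<close>

lemma lookup_smul: "Poly_Mapping.lookup (smul c t) w = c * Poly_Mapping.lookup t w"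
  unfolding smul_def mult_map_scale_conv_mult[symmetric]
  by (simp add: Poly_Mapping.map.rep_eq when_def)

lemma tens_eq_sum: "t = (\<Sum>w\<in>Poly_Mapping.keys t. Poly_Mapping.single w (Poly_Mapping.lookup t w))"
  by (rule poly_mapping_eqI)
     (auto simp: lookup_sum lookup_single when_def sum.delta' in_keys_iff)

lemma tens_induct [case_names zero single add]:
  fixes t :: "('i, 'k::ring_1) tens"
  assumes "P 0" "\<And>w c. P (Poly_Mapping.single w c)" "\<And>s t. P s \<Longrightarrow> P t \<Longrightarrow> P (s + t)"
  shows "P t"
proof -
  have "P (\<Sum>w\<in>A. Poly_Mapping.single w (Poly_Mapping.lookup t w))" if "finite A" for A
    using that by (induction A) (auto intro: assms)
  from this[of "Poly_Mapping.keys t"] show ?thesis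
    using tens_eq_sum[of t] by simp
qed

lemma smul_algebra:
  fixes s t :: "('i, 'k::comm_ring_1) tens"
  shows "smul c (s + t) = smul c s + smul c t" "smul c (s - t) = smul c s - smul c t"
    "smul (c + d) s = smul c s + smul d s"
    "smul c (smul d s) = smul (c * d) s" "smul 1 s = s" "smul 0 s = 0" "smul c 0 = 0"
    "smul c s * t = smul c (s * t)" "smul (- c) s = - smul c s" "smul c (- s) = - smul c s"
proof -
  show "smul c (smul d s) = smul (c * d) s"
    by (simp add: smul_def mult_single flip: mult.assoc)
qed (simp_all add: smul_def distrib_left distrib_right right_diff_distrib single_add mult.assoc single_uminus)

lemma mult_smul:
  fixes s t :: "('i, 'k::comm_ring_1) tens"
  shows "s * smul c t = smul c (s * t)"
proof -
  have "s * Poly_Mapping.single 0 c = Poly_Mapping.single 0 c * s"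
    by (induction s rule: tens_induct) (simp_all add: mult_single algebra_simps)
  then show ?thesis by (simp add: smul_def mult.assoc[symmetric])
qed

lemma ext_diff_add: "ext_diff L x (s + t) = ext_diff L x s + ext_diff L x t"
  unfolding ext_diff_def by (rule setsum_keys_plus_distrib) (simp_all add: smul_algebra)

lemma ext_diff_single: "ext_diff L x (Poly_Mapping.single w c) = smul c (diff_word L x (letters w))"
  by (simp add: ext_diff_def smul_algebra)

lemma ext_diff_gen: "ext_diff L x (gen i) = diff_gen L x i"
  by (simp add: ext_diff_single smul_algebra zero_word_def[symmetric])

lemma diff_word_append:
  fixes L :: "('a::field, 'g::ab_group_add) superalg" and x :: "'b::{finite, linorder} \<Rightarrow> 'g"
  shows "diff_word L x (u @ v) = diff_word L x u * Poly_Mapping.single (Word v) 1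
     + (- 1) ^ length u * (Poly_Mapping.single (Word u) 1 * diff_word L x v)"
proof (induction u)
  case Nil
  then show ?case by (simp add: zero_word_def[symmetric])
next
  case (Cons i u)
  have 1: "Poly_Mapping.single (Word (i # u)) (1::'a) = gen i * Poly_Mapping.single (Word u) 1" for u
    by (simp add: mult_single plus_word_def)
  have 2: "Poly_Mapping.single (Word (u @ v)) (1::'a) = Poly_Mapping.single (Word u) 1 * Poly_Mapping.single (Word v) 1"
    by (simp add: mult_single plus_word_def)
  have 3: "a * ((- 1) ^ n * b) = (- 1) ^ n * (a * b)" for a b :: "('b,'a) tens" and n
    by (cases "even n") auto
  show ?case
    by (simp add: Cons.IH 1[of "u @ v"] 1[of u] 2 distrib_left distrib_right left_diff_distrib right_diff_distrib 3[of "gen i"] mult.assoc)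
qed

lemma ext_diff_mult:
  fixes L :: "('a::field, 'g::ab_group_add) superalg" and s t :: "('c::{finite, linorder}, 'a) tens"
  assumes "\<forall>w \<in> Poly_Mapping.keys s. length (letters w) = n"
  shows "ext_diff L x (s * t) = ext_diff L x s * t + (- 1) ^ n * (s * ext_diff L x t)"
proof -
  have sg: "(- 1) ^ n * smul c t = smul c ((- 1) ^ n * t)" for c :: 'a and t :: "('c, 'a) tens"
    by (cases "even n") (simp_all add: smul_algebra)
  have 1: "ext_diff L x (Poly_Mapping.single w c * t) =
      ext_diff L x (Poly_Mapping.single w c) * t + (- 1) ^ n * (Poly_Mapping.single w c * ext_diff L x t)"
    if w: "length (letters w) = n" for w c t
  proof (induction t rule: tens_induct)
    case zero
    then show ?case by (simp add: ext_diff_def)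
  next
    case (single v d)
    have 2: "Poly_Mapping.single u a = smul a (Poly_Mapping.single (Word (letters u)) 1)" for u :: "'c word" and a :: 'a
      by (simp add: smul_def mult_single)
    show ?case
      using w by (simp add: ext_diff_single mult_single plus_word_def diff_word_append)
        (simp add: 2[of w c] 2[of v d] smul_algebra mult_smul sg mult.commute)
  next
    case (add s t)
    then show ?case by (simp add: distrib_left ext_diff_add)
  qed
  have "ext_diff L x ((\<Sum>w\<in>A. Poly_Mapping.single w (Poly_Mapping.lookup s w)) * t) =
      ext_diff L x (\<Sum>w\<in>A. Poly_Mapping.single w (Poly_Mapping.lookup s w)) * t +
      (- 1) ^ n * ((\<Sum>w\<in>A. Poly_Mapping.single w (Poly_Mapping.lookup s w)) * ext_diff L x t)"
    if "finite A" "A \<subseteq> Poly_Mapping.keys s" for A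
    using that
  proof (induction A)
    case empty
    then show ?case by (simp add: ext_diff_def)
  next
    case (insert w A)
    then show ?case
      using 1[of w] assms by (simp add: ext_diff_add distrib_left distrib_right)
  qed
  from this[of "Poly_Mapping.keys s"] show ?thesis
    using tens_eq_sum[of s] by simp
qed

context
  fixes L :: "('k::field, 'g::ab_group_add) superalg" and x :: "'i::{finite, linorder} \<Rightarrow> 'g"
  assumes L: "lie_superalgebra L" and x: "homogeneous_basis L x"
begin

interpretation vector_space "scl L" by (rule lie_superalgebra.vector_space[OF L])

lemma coord_linear:
  "coord L x (u + v) i = coord L x u i + coord L x v i"
  "coord L x (scl L c u) i = c * coord L x u i"
  "coord L x 0 i = 0"
  "coord L x (x j) i = (if i = j then 1 else 0)"
proof -
  have x: "inj x" "independent (range x)" "span (range x) = UNIV"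
    using x by (simp_all add: homogeneous_basis_def)
  show "coord L x (u + v) i = coord L x u i + coord L x v i"
    "coord L x (scl L c u) i = c * coord L x u i" "coord L x 0 i = 0"
    using x by (simp_all add: coord_def representation_add representation_scale representation_zero)
  show "coord L x (x j) i = (if i = j then 1 else 0)"
    using x by (auto simp: coord_def representation_basis inj_eq)
qed

lemma coord_sum: "coord L x (\<Sum>j\<in>A. f j) i = (\<Sum>j\<in>A. coord L x (f j) i)"
  by (induction A rule: infinite_finite_induct) (simp_all add: coord_linear)

lemma sum_coord: "(\<Sum>i\<in>UNIV. scl L (coord L x v i) (x i)) = v"
proof -
  have x: "inj x" "independent (range x)" "span (range x) = UNIV"
    using x by (simp_all add: homogeneous_basis_def)
  have "v = (\<Sum>b\<in>range x. scl L (representation (range x) v b) b)"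
    by (rule sum_representation_eq[symmetric]) (use x in auto)
  also have "\<dots> = (\<Sum>i\<in>UNIV. scl L (coord L x v i) (x i))"
    by (subst sum.reindex) (use x in \<open>simp_all add: coord_def\<close>)
  finally show ?thesis by simp
qed

lemma gr_par: "x i \<in> gr L (par L x i)"
proof -
  obtain p where "x i \<in> gr L p" using x by (auto simp: homogeneous_basis_def)
  then show ?thesis by (cases p) (auto simp: par_def)
qed

lemma coord_gr:
  assumes "m \<in> gr L p" "par L x i \<noteq> p"
  shows "coord L x m i = 0"
proof -
  interpret lie_superalgebra L by (rule L)
  have bit: "q = r + 1" if "q \<noteq> r" for q r :: bit
    using that by (cases q; cases r) simp_all
  define A where "A = {i. par L x i = p}"
  have s: "(\<Sum>i\<in>B. scl L (coord L x m i) (x i)) \<in> gr L q" if "\<forall>i\<in>B. par L x i = q" for B q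
    using that gr_par by (intro subspace_sum subspace_gr subspace_scale) metis
  have eq: "m = (\<Sum>i\<in>A. scl L (coord L x m i) (x i)) + (\<Sum>i\<in>- A. scl L (coord L x m i) (x i))" (is "_ = ?s + ?t")
    using sum_coord[of m] sum.subset_diff[of A UNIV "\<lambda>i. scl L (coord L x m i) (x i)"]
    by (simp add: Compl_eq_Diff_UNIV add.commute)
  have "?t \<in> gr L (p + 1)"
    by (rule s) (use bit in \<open>auto simp: A_def\<close>)
  moreover have "?t = m - ?s"
    using eq by (metis add_diff_cancel_left')
  then have "?t \<in> gr L p"
    using assms(1) s[of A p] subspace_diff[OF subspace_gr] by (simp add: A_def)
  ultimately have "?t = 0"
    using gr_inter by (cases p) auto
  then have "0 = coord L x ?t i" by (simp add: coord_linear)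
  also have "\<dots> = (\<Sum>j\<in>- A. if j = i then coord L x m j else 0)"
    unfolding coord_sum by (rule sum.cong) (simp_all add: coord_linear)
  also have "\<dots> = coord L x m i"
    using assms(2) by (simp add: sum.delta' A_def)
  finally show ?thesis by simp
qed

lemma brk_linear:
  "brk L u (v + w) = brk L u v + brk L u w" "brk L (u + v) w = brk L u w + brk L v w"
  "brk L u (scl L c v) = scl L c (brk L u v)" "brk L (scl L c u) v = scl L c (brk L u v)"
  "brk L u 0 = 0" "brk L 0 u = 0"
proof -
  have r: "module_hom (scl L) (scl L) (\<lambda>v. brk L u v)" for u
    using lie_superalgebra.linear_right[OF L, of u] by (rule Vector_Spaces.linear.axioms(3))
  have l: "module_hom (scl L) (scl L) (\<lambda>u. brk L u v)" for v
    using lie_superalgebra.linear_left[OF L, of v] by (rule Vector_Spaces.linear.axioms(3))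
  show "brk L u (v + w) = brk L u v + brk L u w" "brk L (u + v) w = brk L u w + brk L v w"
    "brk L u (scl L c v) = scl L c (brk L u v)" "brk L (scl L c u) v = scl L c (brk L u v)"
    "brk L u 0 = 0" "brk L 0 u = 0"
    by (fact module_hom.add[OF r] module_hom.add[OF l] module_hom.scale[OF r] module_hom.scale[OF l]
        module_hom.zero[OF r] module_hom.zero[OF l])+
qed

lemma brk_sum:
  "brk L u (\<Sum>i\<in>A. f i) = (\<Sum>i\<in>A. brk L u (f i))" "brk L (\<Sum>i\<in>A. f i) u = (\<Sum>i\<in>A. brk L (f i) u)"
  by (induction A rule: infinite_finite_induct) (simp_all add: brk_linear)

lemma tensor_linear:
  "tensor L x (m + n) t = tensor L x m t + tensor L x n t"
  "tensor L x m (t + s) = tensor L x m t + tensor L x m s"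
  "tensor L x (scl L c m) t = tensor L x m (smul c t)"
  "tensor L x 0 t = 0" "tensor L x m 0 = 0"
  by (auto simp: tensor_def fun_eq_iff coord_linear smul_algebra mult.commute)

lemma tensor_sum: "tensor L x (\<Sum>i\<in>A. f i) t = (\<Sum>i\<in>A. tensor L x (f i) t)"
  by (induction A rule: infinite_finite_induct) (simp_all add: tensor_linear)

lemma sg_smul: "sg p * smul c t = smul c (sg p * t)" for t :: "('i, 'k) tens"
  by (simp add: sg_def smul_algebra)

lemma ext_diff_smul: "ext_diff L x (smul c t) = smul c (ext_diff L x t)"
  by (induction t rule: tens_induct)
    (simp_all add: smul_algebra ext_diff_add ext_diff_single mult_single, simp_all add: ext_diff_def smul_algebra smul_def mult_single)

lemma cochain_diff_tensor:
  assumes m: "m \<in> gr L p"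
  shows "cochain_diff L x (tensor L x m t) =
    (\<Sum>j\<in>UNIV. tensor L x (brk L (x j) m) (sg (par L x j * p) * (gen j * t))) + tensor L x m (ext_diff L x t)"
proof -
  have 1: "tensor L x u (sg (par L x j * par L x i) * (gen j * smul (coord L x m i) t)) =
      tensor L x (scl L (coord L x m i) u) (sg (par L x j * p) * (gen j * t))" for u i j
    using coord_gr[OF m, of i]
    by (cases "par L x i = p") (simp_all add: tensor_linear mult_smul sg_smul smul_algebra)
  have "cochain_diff L x (tensor L x m t) =
      (\<Sum>i\<in>UNIV. (\<Sum>j\<in>UNIV. tensor L x (scl L (coord L x m i) (brk L (x j) (x i))) (sg (par L x j * p) * (gen j * t)))
        + tensor L x (scl L (coord L x m i) (x i)) (ext_diff L x t))"
    unfolding cochain_diff_def tensor_def[of L x m t] 1 ext_diff_smul tensor_linear(3) ..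
  also have "\<dots> = (\<Sum>j\<in>UNIV. tensor L x (brk L (x j) (\<Sum>i\<in>UNIV. scl L (coord L x m i) (x i))) (sg (par L x j * p) * (gen j * t)))
        + tensor L x (\<Sum>i\<in>UNIV. scl L (coord L x m i) (x i)) (ext_diff L x t)"
    unfolding sum.distrib tensor_sum brk_sum brk_linear
    by (subst sum.swap) (rule refl)
  finally show ?thesis by (simp add: sum_coord)
qed

lemma par_part_homogeneous:
  assumes "\<forall>w \<in> Poly_Mapping.keys t. par_word L x w = q"
  shows "par_part L x p (smul c t) = (if p = q then smul c t else 0)"
proof -
  have "Poly_Mapping.keys (smul c t) \<subseteq> Poly_Mapping.keys t"
    by (auto simp: in_keys_iff lookup_smul)
  then have "{w \<in> Poly_Mapping.keys (smul c t). par_word L x w = p} =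
      (if p = q then Poly_Mapping.keys (smul c t) else {})"
    using assms by auto
  then show ?thesis
    using tens_eq_sum[of "smul c t"] by (simp add: par_part_def)
qed

lemma cup_tensor:
  assumes t: "\<forall>w \<in> Poly_Mapping.keys t. par_word L x w = q" and b: "b \<in> gr L p"
  shows "cup L x (tensor L x a t) (tensor L x b s) = tensor L x (brk L a b) (sg (q * p) * (t * s))"
proof -
  have 1: "(\<Sum>r\<in>{0, 1}. tensor L x (brk L (x i) (x j)) (sg (r * par L x j) *
        (par_part L x r (smul (coord L x a i) t) * smul (coord L x b j) s))) =
      tensor L x (brk L (scl L (coord L x a i) (x i)) (scl L (coord L x b j) (x j))) (sg (q * p) * (t * s))" (is "?l = ?r") for i j
  proof -
    have "?l = (\<Sum>r\<in>{0, 1}. if r = q then tensor L x (brk L (x i) (x j)) (sg (q * par L x j) *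
        (smul (coord L x a i) t * smul (coord L x b j) s)) else 0)"
      by (rule sum.cong) (simp_all add: par_part_homogeneous[OF t] tensor_linear)
    also have "\<dots> = ?r"
      using coord_gr[OF b, of j]
      by (cases "par L x j = p")
        (cases q; simp add: tensor_linear brk_linear mult_smul sg_smul smul_algebra mult.commute)+
    finally show ?thesis .
  qed
  have "cup L x (tensor L x a t) (tensor L x b s) = (\<Sum>i\<in>UNIV. \<Sum>j\<in>UNIV.
      tensor L x (brk L (scl L (coord L x a i) (x i)) (scl L (coord L x b j) (x j))) (sg (q * p) * (t * s)))"
    unfolding cup_def 1[symmetric] tensor_def[of L x a t] tensor_def[of L x b s] ..
  also have "\<dots> = tensor L x (brk L (\<Sum>i\<in>UNIV. scl L (coord L x a i) (x i)) (\<Sum>j\<in>UNIV. scl L (coord L x b j) (x j))) (sg (q * p) * (t * s))"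
    unfolding brk_sum tensor_sum by (rule sum.swap)
  finally show ?thesis by (simp add: sum_coord)
qed

end
end

theory Submission
  imports Defs
begin

text \<open>
  Write \<open>Z = [\<gg>, \<gg>]\<close>, so that \<open>V\<^sup>*\<close> is the space of functionals that kill \<open>Z\<close>. The two conditions
  are so strong that \<open>\<gg>\<close> must be a Heisenberg-like superalgebra with even one-dimensional centre
  \<open>Z\<close>, and for such an algebra the cocycles can be described completely.

  \<^emph>\<open>The derived algebra is a line\<close> (\<open>derived_line\<close>). The differential of a \<open>0\<close>-cochain \<open>c\<close> is
  the bracket with \<open>c\<close>. So condition (1) for \<open>k = 1\<close> says that for every \<open>m \<in> Z\<close> and
  \<open>h \<in> V\<^sup>*\<close> some \<open>c\<close> satisfies \<open>[c, u] = h(u) m\<close> for all \<open>u\<close> (\<open>bracket_realizes\<close>). Let \<open>z\<close> be a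
  non-zero homogeneous bracket, \<open>\<alpha>\<close> a homogeneous functional with \<open>\<alpha>(z) = 1\<close>, and suppose
  \<open>m \<in> Z\<close> has \<open>\<alpha>(m) = 0\<close>. An element \<open>c\<close> belonging to \<open>m\<close> and some \<open>h \<noteq> 0\<close> is orthogonal to
  everything for the form \<open>\<omega>(u, v) = \<alpha>[u, v]\<close>; but the elements belonging to \<open>z\<close> and \<open>h'\<close> pair
  with \<open>c\<close> to \<open>h'(c)\<close>. Hence all \<open>h' \<in> V\<^sup>*\<close> kill \<open>c\<close>, so \<open>c \<in> Z\<close> is central and \<open>m = 0\<close>.
  This shows that \<open>Z\<close> is spanned by \<open>z\<close>.

  \<^emph>\<open>The line is even\<close> (\<open>center_even\<close>). Let \<open>\<phi>\<close> be the covector of \<open>\<alpha>\<close> and \<open>\<Omega> = d\<phi>\<close> (\<open>Omega\<close>). Condition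
  (2) says that \<open>\<Omega>\<close> is a non-zero-divisor on \<open>\<And>V\<^sup>*\<close> (\<open>Omega_regular\<close>). If \<open>z\<close> were odd, each term
  of \<open>\<Omega>\<close> would contain an even covector of \<open>V\<^sup>*\<close>. Even covectors anticommute and square to
  zero, so a longest non-zero product of them is annihilated by \<open>\<Omega>\<close>, a contradiction.

  \<^emph>\<open>Closed forms are horizontal\<close> (\<open>closed_horizontal\<close>). As \<open>\<phi>\<close> is even, every form is
  \<open>a + \<phi> \<and> g\<close> with \<open>a, g \<in> \<And>V\<^sup>*\<close>, and \<open>d(a + \<phi> \<and> g) = \<Omega> \<and> g\<close>. If this vanishes, then
  \<open>g = 0\<close>.

  \<^emph>\<open>The cup product\<close> (\<open>cup_trivial\<close>). Since \<open>Z\<close> is central, the cup product depends only on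
  the cochains modulo \<open>Z\<close>, and its values lie in \<open>z \<otimes> \<And>\<gg>\<^sup>*\<close>. Modulo \<open>Z\<close> the bracket disappears from
  the differential, so the coefficients of a cocycle modulo \<open>Z\<close> are closed forms, hence
  lie in \<open>\<And>V\<^sup>*\<close>. So the cup product of two cocycles lies in \<open>z \<otimes> \<And>V\<^sup>*\<close>. Its component in degree
  \<open>0\<close> is the bracket of the constant parts of the two cocycles, which are central; the components
  of degree \<open>k \<ge> 1\<close> are coboundaries by condition (1).

  Forms are represented by tensors, and a cohomology class contains all representatives. The argument
  therefore has to run with equalities modulo \<open>ext_ideal\<close>, and the description of the coefficients
  has to hold for coboundaries as well: this is \<open>admissible\<close>, and it needs \<open>\<Omega>\<close> itself to
  be horizontal (\<open>Omega_horizontal\<close>).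
\<close>

section \<open>Words and homogeneous parts of tensors\<close>

abbreviation tword :: "'i list \<Rightarrow> ('i, 'k::ring_1) tens" where
  "tword u \<equiv> Poly_Mapping.single (Word u) 1"

lemma tword_Nil: "tword [] = 1"
  by (simp add: zero_word_def[symmetric])

lemma tword_append: "tword (u @ v) = tword u * tword v"
  by (simp add: mult_single plus_word_def)

lemma tword_Cons: "tword (i # v) = gen i * tword v"
  by (simp add: mult_single plus_word_def)

lemma tword_Cons_Cons: "tword (i # j # v) = gen i * gen j * tword v"
  by (simp add: mult_single plus_word_def)

lemma single_eq_smul: "Poly_Mapping.single w c = smul c (tword (letters w))"
  by (simp add: smul_def mult_single)

lemma tens_word_induct [case_names zero word add]:
  fixes t :: "('i, 'k::ring_1) tens"
  assumes "Q 0" "\<And>c u. Q (smul c (tword u))" "\<And>s t. Q s \<Longrightarrow> Q t \<Longrightarrow> Q (s + t)"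
  shows "Q t"
proof (induction t rule: tens_induct)
  case (single w c)
  show ?case by (subst single_eq_smul) (rule assms(2))
qed (use assms in blast)+

lemma sg_mult_smul: "sg p * t = smul (sg p) t" for t :: "('i, 'k::comm_ring_1) tens"
  by (simp add: sg_def smul_algebra)

lemma smul_sum: "smul c (\<Sum>i\<in>A. f i) = (\<Sum>i\<in>A. smul c (f i))"
  for f :: "'a \<Rightarrow> ('i, 'k::comm_ring_1) tens"
  by (induction A rule: infinite_finite_induct) (simp_all add: smul_algebra)

lemma sum_smul: "smul (\<Sum>i\<in>A. f i) t = (\<Sum>i\<in>A. smul (f i) t)"
  for t :: "('i, 'k::comm_ring_1) tens"
  by (induction A rule: infinite_finite_induct) (simp_all add: smul_algebra)

interpretation tens: vector_space "smul :: 'k::field \<Rightarrow> ('i, 'k) tens \<Rightarrow> ('i, 'k) tens"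
  by standard (simp_all add: smul_algebra)

lemma keys_mult_rule:
  assumes "w \<in> Poly_Mapping.keys (s * t)"
  obtains u v where "w = u + v" "u \<in> Poly_Mapping.keys s" "v \<in> Poly_Mapping.keys t"
  using assms Poly_Mapping.keys_mult[of s t] by blast

lemma keys_smul: "w \<in> Poly_Mapping.keys (smul c t) \<Longrightarrow> w \<in> Poly_Mapping.keys t"
  by (auto simp: in_keys_iff lookup_smul)

lemma letters_plus: "letters (u + v) = letters u @ letters v"
  by (simp add: plus_word_def)

text \<open>
  Arbitrary predicates on words let one calculus serve the \<open>\<int>\<close>-grading, the \<open>\<int>\<^sub>2\<close>-grading and
  combinations of both.
\<close>

definition part :: "('i word \<Rightarrow> bool) \<Rightarrow> ('i, 'k::ring_1) tens \<Rightarrow> ('i, 'k) tens" where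
  "part R t = (\<Sum>w | w \<in> Poly_Mapping.keys t \<and> R w. Poly_Mapping.single w (Poly_Mapping.lookup t w))"

lemma par_part_eq_part: "par_part L x p = part (\<lambda>w. par_word L x w = p)"
  by (simp add: fun_eq_iff par_part_def part_def)

lemma lookup_part: "Poly_Mapping.lookup (part R t) w = (if R w then Poly_Mapping.lookup t w else 0)"
  unfolding part_def
  by (auto simp: lookup_sum lookup_single when_def sum.delta' in_keys_iff)

lemma part_algebra:
  fixes s t :: "('i, 'k::comm_ring_1) tens"
  shows "part R (s + t) = part R s + part R t" "part R (s - t) = part R s - part R t"
    "part R (smul c t) = smul c (part R t)" "part R (0 :: ('i, 'k) tens) = 0"
  by (rule poly_mapping_eqI; simp add: lookup_part lookup_add lookup_minus lookup_smul)+

lemma part_homogeneous: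
  assumes "\<And>w. w \<in> Poly_Mapping.keys t \<Longrightarrow> R w = b"
  shows "part R t = (if b then t else 0)"
  by (rule poly_mapping_eqI) (use assms in \<open>auto simp: lookup_part in_keys_iff\<close>)

text \<open>
  The rule by which a homogeneous left factor moves out of a component, with the degree of the
  component shifted accordingly.
\<close>

lemma part_mult:
  fixes s t :: "('i, 'k::comm_ring_1) tens"
  assumes "\<And>w v. w \<in> Poly_Mapping.keys s \<Longrightarrow> R (w + v) = R' v"
  shows "part R (s * t) = s * part R' t"
proof -
  have *: "part R (Poly_Mapping.single w c * t) = Poly_Mapping.single w c * part R' t"
    if w: "\<And>v. R (w + v) = R' v" for w c
  proof (induction t rule: tens_induct)
    case zero
    then show ?case by (simp add: part_algebra)
  next
    case (single v d)
    show ?case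
      by (subst (1 2) part_homogeneous[where b = "R' v"]) (auto simp: mult_single w split: if_splits)
  next
    case (add s t)
    then show ?case by (simp add: part_algebra distrib_left)
  qed
  have "part R ((\<Sum>w\<in>A. Poly_Mapping.single w (Poly_Mapping.lookup s w)) * t) =
      (\<Sum>w\<in>A. Poly_Mapping.single w (Poly_Mapping.lookup s w)) * part R' t"
    if "finite A" "A \<subseteq> Poly_Mapping.keys s" for A
    using that by (induction A) (simp_all add: part_algebra distrib_right * assms)
  from this[of "Poly_Mapping.keys s"] show ?thesis
    using tens_eq_sum[of s] by simp
qed

abbreviation len_part :: "nat \<Rightarrow> ('i, 'k::ring_1) tens \<Rightarrow> ('i, 'k) tens" where
  "len_part k \<equiv> part (\<lambda>w. length (letters w) = k)"

lemma len_part_0: "len_part 0 t = smul (Poly_Mapping.lookup t 0) 1"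
  for t :: "('i, 'k::comm_ring_1) tens"
proof (rule poly_mapping_eqI)
  fix w :: "'i word"
  show "Poly_Mapping.lookup (len_part 0 t) w = Poly_Mapping.lookup (smul (Poly_Mapping.lookup t 0) 1) w"
    by (cases w) (auto simp: lookup_part lookup_smul lookup_one zero_word_def when_def)
qed

lemma len_part_decomposition:
  fixes t :: "('i, 'k::comm_ring_1) tens"
  obtains N where "t = (\<Sum>k\<le>N. len_part k t)"
proof -
  obtain N where N: "\<forall>n \<in> (\<lambda>w. length (letters w)) ` Poly_Mapping.keys t. n \<le> N"
    using finite_nat_set_iff_bounded_le[of "(\<lambda>w. length (letters w)) ` Poly_Mapping.keys t"] by auto
  have "t = (\<Sum>k\<le>N. len_part k t)"
  proof (rule poly_mapping_eqI)
    fix w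
    show "Poly_Mapping.lookup t w = Poly_Mapping.lookup (\<Sum>k\<le>N. len_part k t) w"
      using N by (cases "w \<in> Poly_Mapping.keys t") (auto simp: lookup_sum lookup_part in_keys_iff)
  qed
  then show ?thesis by (rule that)
qed

section \<open>Superalgebras with a homogeneous basis\<close>

locale based_superalgebra = lie_superalgebra L
  for L :: "('k::field_char_0, 'g::ab_group_add) superalg" +
  fixes x :: "'i::{finite, linorder} \<Rightarrow> 'g"
  assumes basis: "homogeneous_basis L x"
begin

sublocale vs: vector_space "scl L" by (rule vector_space)

lemmas coord_linear = Defs.coord_linear[OF lie_superalgebra_axioms basis]
lemmas coord_sum = Defs.coord_sum[OF lie_superalgebra_axioms basis]
lemmas sum_coord = Defs.sum_coord[OF lie_superalgebra_axioms basis]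
lemmas gr_par = Defs.gr_par[OF lie_superalgebra_axioms basis]
lemmas coord_gr = Defs.coord_gr[OF lie_superalgebra_axioms basis]
lemmas brk_linear = Defs.brk_linear[OF lie_superalgebra_axioms basis]
lemmas brk_sum = Defs.brk_sum[OF lie_superalgebra_axioms basis]
lemmas tensor_linear = Defs.tensor_linear[OF lie_superalgebra_axioms basis]
lemmas ext_diff_smul = Defs.ext_diff_smul[OF lie_superalgebra_axioms basis]

abbreviation "ideal \<equiv> ext_ideal L x"
abbreviation "P \<equiv> par L x"

lemma vec_eqI: "(\<And>i. coord L x u i = coord L x v i) \<Longrightarrow> u = v"
  by (subst (2) sum_coord[symmetric], subst sum_coord[of u, symmetric]) simp

lemma dualD:
  assumes "h \<in> dual L"
  shows "h (u + v) = h u + h v" "h (scl L c u) = c * h u" "h 0 = 0" "h (u - v) = h u - h v"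
    "h (\<Sum>i\<in>A. f i) = (\<Sum>i\<in>A. h (f i))"
proof -
  interpret Vector_Spaces.linear "scl L" "(*)" h using assms by (simp add: dual_def)
  show "h (u + v) = h u + h v" "h (scl L c u) = c * h u" "h 0 = 0" "h (u - v) = h u - h v"
    "h (\<Sum>i\<in>A. f i) = (\<Sum>i\<in>A. h (f i))"
    by (simp_all add: add scale diff sum)
qed

lemma dual_expand:
  assumes "h \<in> dual L"
  shows "h u = (\<Sum>i\<in>UNIV. coord L x u i * h (x i))"
  by (subst sum_coord[of u, symmetric]) (simp only: dualD[OF assms])

lemma vector_space_field: "vector_space ((*) :: 'k \<Rightarrow> 'k \<Rightarrow> 'k)"
  by standard (simp_all add: algebra_simps)

lemma dualI:
  assumes "\<And>u v. h (u + v) = h u + h v" "\<And>c u. h (scl L c u) = c * h u"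
  shows "h \<in> dual L"
proof -
  interpret K: vector_space "(*) :: 'k \<Rightarrow> 'k \<Rightarrow> 'k" by (rule vector_space_field)
  show ?thesis
    using assms unfolding dual_def by (auto intro!: Vector_Spaces.linear.intro module_hom.intro
      module_hom_axioms.intro vector_space K.vector_space_axioms vs.module_axioms K.module_axioms)
qed

lemma coord_dual: "(\<lambda>u. coord L x u i) \<in> dual L"
  by (rule dualI) (simp_all add: coord_linear)

lemma coord_dual_gr: "(\<lambda>u. coord L x u i) \<in> dual_gr L (P i)"
proof -
  have "P i \<noteq> P i + 1" by (cases "P i") simp_all
  then show ?thesis
    using coord_dual coord_gr by (auto simp: dual_gr_def)
qed

lemma dual_gr_basis:
  assumes "h \<in> dual_gr L p" "h (x i) \<noteq> 0"
  shows "P i = p"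
proof (rule ccontr)
  assume "P i \<noteq> p"
  then have "P i = p + 1" by (cases "P i"; cases p) simp_all
  then show False using assms gr_par[of i] by (simp add: dual_gr_def)
qed

lemma covec_coord: "covec x (\<lambda>u. coord L x u i) = gen i"
proof -
  have "smul (coord L x (x j) i) (gen j) = (if i = j then gen j else 0)" for j :: 'i
    by (simp add: coord_linear smul_algebra)
  then show ?thesis by (simp add: covec_def)
qed

lemma lookup_covec: "Poly_Mapping.lookup (covec x h) (Word [i]) = h (x i)"
proof -
  have "h (x j) * Poly_Mapping.lookup (gen j) (Word [i]) = (if j = i then h (x j) else 0)" for j
    by (simp add: lookup_single)
  then show ?thesis by (simp add: covec_def lookup_sum lookup_smul)
qed

text \<open>
  Extend a basis of \<open>W\<close> by \<open>u\<close>. This is used twice: for \<open>W = [\<gg>, \<gg>]\<close> it says that the derived algebra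
  is cut out by functionals, for \<open>W = V\<close> it gives the functional to which condition (2) is applied.
\<close>

lemma separate:
  assumes W: "module.subspace (scl L) W" and u: "u \<notin> W"
  obtains h where "h \<in> annihilator L W" "h u = 1"
proof -
  interpret K: vector_space "(*) :: 'k \<Rightarrow> 'k \<Rightarrow> 'k" by (rule vector_space_field)
  interpret pair: vector_space_pair "scl L" "(*) :: 'k \<Rightarrow> 'k \<Rightarrow> 'k" ..
  obtain B where B: "B \<subseteq> W" "vs.independent B" "W \<subseteq> vs.span B"
    using vs.maximal_independent_subset[of W] by metis
  have span: "vs.span B = W"
    using B W by (simp add: vs.span_subspace)
  have "vs.independent (insert u B)"
    using B(2) u span vs.independent_insert by auto
  then obtain h where h: "Vector_Spaces.linear (scl L) (*) h"
      "\<forall>b\<in>insert u B. h b = (if b = u then 1 else 0)"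
    using pair.linear_independent_extend[of "insert u B" "\<lambda>b. if b = u then 1 else 0"] by blast
  have hd: "h \<in> dual L" using h(1) by (simp add: dual_def)
  have "h w = 0" if "w \<in> W" for w
  proof -
    have "w \<in> vs.span B" using that span by simp
    then show ?thesis
    proof (induction rule: vs.span_induct_alt)
      case base
      then show ?case by (simp add: dualD[OF hd])
    next
      case (step c b w)
      then have "b \<noteq> u" using B(1) u by blast
      then show ?case using step h(2) by (simp add: dualD[OF hd])
    qed
  qed
  then show ?thesis using that[of h] h(2) hd by (simp add: annihilator_def)
qed

section \<open>The ideal of the super-exterior algebra\<close>

text \<open>
  A separate constant keeps the product of two parities away from the simplifier, which would
  rewrite it into a case distinction.
\<close>

definition koszul :: "'i \<Rightarrow> 'i \<Rightarrow> 'k" where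
  "koszul i j = sg (P i * P j)"

abbreviation rel :: "'i \<Rightarrow> 'i \<Rightarrow> ('i, 'k) tens" where
  "rel i j \<equiv> gen i * gen j + smul (koszul i j) (gen j * gen i)"

lemma ideal_closed:
  shows "0 \<in> ideal" "s \<in> ideal \<Longrightarrow> t \<in> ideal \<Longrightarrow> s + t \<in> ideal" "t \<in> ideal \<Longrightarrow> a * t \<in> ideal"
    "t \<in> ideal \<Longrightarrow> t * a \<in> ideal" "t \<in> ideal \<Longrightarrow> - t \<in> ideal"
    "s \<in> ideal \<Longrightarrow> t \<in> ideal \<Longrightarrow> s - t \<in> ideal" "t \<in> ideal \<Longrightarrow> smul c t \<in> ideal"
proof -
  show "0 \<in> ideal" "t \<in> ideal \<Longrightarrow> t * a \<in> ideal"
    by (simp_all add: ext_ideal_def two_sided_ideal.zero two_sided_ideal.right)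
  show add: "s \<in> ideal \<Longrightarrow> t \<in> ideal \<Longrightarrow> s + t \<in> ideal" for s t
    by (simp add: ext_ideal_def two_sided_ideal.add)
  show left: "t \<in> ideal \<Longrightarrow> a * t \<in> ideal" for t a
    by (simp add: ext_ideal_def two_sided_ideal.left)
  show minus: "t \<in> ideal \<Longrightarrow> - t \<in> ideal" for t
    using left[of t "- 1"] by simp
  show "s \<in> ideal \<Longrightarrow> t \<in> ideal \<Longrightarrow> s - t \<in> ideal"
    using add[OF _ minus, of s t] by simp
  show "t \<in> ideal \<Longrightarrow> smul c t \<in> ideal"
    unfolding smul_def by (rule left)
qed

lemma ideal_sum: "(\<And>i. i \<in> A \<Longrightarrow> f i \<in> ideal) \<Longrightarrow> (\<Sum>i\<in>A. f i) \<in> ideal"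
  by (induction A rule: infinite_finite_induct) (simp_all add: ideal_closed)

lemma covec_anticommute:
  assumes "f \<in> dual_gr L p" "h \<in> dual_gr L q"
  shows "covec x f * covec x h + smul (sg (p * q)) (covec x h * covec x f) \<in> ideal"
  unfolding ext_ideal_def sg_mult_smul[symmetric]
  by (rule two_sided_ideal.base)
    (intro CollectI exI[of _ f] exI[of _ h] exI[of _ p] exI[of _ q] conjI refl assms)

lemma rel_in_ideal: "rel i j \<in> ideal"
  using covec_anticommute[OF coord_dual_gr coord_dual_gr, of i j]
  by (simp only: covec_coord koszul_def)

lemma ideal_half: "t + t \<in> ideal \<Longrightarrow> t \<in> ideal"
proof -
  have "smul (1 / 2) (t + t) = t"
    unfolding smul_algebra(1) smul_algebra(3)[symmetric] by (simp add: smul_algebra)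
  then show "t + t \<in> ideal \<Longrightarrow> t \<in> ideal"
    using ideal_closed(7)[of "t + t" "1/2"] by simp
qed

text \<open>
  The ideal is spanned additively by the multiples \<open>u r v\<close> of the commutation relations \<open>r\<close> between
  basis covectors: expanding the two covectors of a generator in the basis leaves only basis
  covectors of the right parity. The induction is on \<open>a t b\<close> for all \<open>a\<close> and \<open>b\<close>, which absorbs
  the closure of the ideal under multiplication.
\<close>

lemma ideal_induct [consumes 1, case_names zero add rel]:
  assumes t: "t \<in> ideal"
    and zero: "Q 0" and add: "\<And>s t. Q s \<Longrightarrow> Q t \<Longrightarrow> Q (s + t)"
    and rel: "\<And>c u i j v. Q (smul c (tword u * rel i j * tword v))"
  shows "Q t"
proof -
  have sum: "Q (\<Sum>i\<in>A. f i)" if "\<And>i. Q (f i)" for A and f :: "'i \<Rightarrow> ('i, 'k) tens"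
    using that by (induction A rule: infinite_finite_induct) (simp_all add: zero add)
  have rel': "Q (a * smul c (rel i j) * b)" for a b c i j
  proof (induction a rule: tens_word_induct)
    case (word d u)
    show ?case
    proof (induction b rule: tens_word_induct)
      case (word d' v)
      have "smul d (tword u) * smul c (rel i j) * smul d' (tword v) =
          smul (d * c * d') (tword u * rel i j * tword v)"
        unfolding mult_smul smul_algebra(4,8) by (simp add: ac_simps)
      then show ?case by (metis rel)
    qed (simp_all add: zero add distrib_left)
  qed (simp_all add: zero add distrib_right)
  have "\<forall>a b. Q (a * t * b)"
    using t unfolding ext_ideal_def
  proof (induction rule: two_sided_ideal.induct)
    case (base s)
    then obtain f h p q where s: "s = covec x f * covec x h + sg (p * q) * (covec x h * covec x f)"
      and f: "f \<in> dual_gr L p" and h: "h \<in> dual_gr L q"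
      by blast
    have eq: "smul (f (x i)) (gen i) * smul (h (x j)) (gen j) +
        smul (sg (p * q)) (smul (h (x j)) (gen j) * smul (f (x i)) (gen i)) = smul (f (x i) * h (x j)) (rel i j)" for i j
      using dual_gr_basis[OF f, of i] dual_gr_basis[OF h, of j]
      by (cases "f (x i) = 0"; cases "h (x j) = 0") (simp_all add: smul_algebra mult_smul mult.commute koszul_def)
    have s_sum: "s = (\<Sum>i\<in>UNIV. \<Sum>j\<in>UNIV. smul (f (x i) * h (x j)) (rel i j))"
      unfolding s covec_def sum_product sg_mult_smul eq[symmetric] sum.distrib smul_sum
      by (subst (2) sum.swap) (rule refl)
    have "Q (a * s * b)" for a b
      unfolding s_sum sum_distrib_left sum_distrib_right by (intro sum rel')
    then show ?case by blast
  next
    case (left s a)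
    then show ?case by (metis mult.assoc)
  next
    case (right s a)
    then show ?case by (metis mult.assoc)
  qed (simp_all add: zero add distrib_left distrib_right)
  from this[rule_format, of 1 1] show ?thesis by simp
qed

lemma smul_rel: "smul c (tword u * rel i j * tword v) =
    smul c (tword (u @ i # j # v)) + smul (c * koszul i j) (tword (u @ j # i # v))"
  by (simp add: tword_append tword_Cons_Cons distrib_left distrib_right smul_algebra mult_smul mult.assoc)

text \<open>
  The relations are quadratic. So equality modulo the ideal is plain equality in degrees
  \<open>0\<close> and \<open>1\<close>; this is what allows coefficients to be read off.
\<close>

lemma ideal_low_degree:
  assumes "t \<in> ideal" "length (letters w) < 2"
  shows "Poly_Mapping.lookup t w = 0"
  using assms(1)
proof (induction rule: ideal_induct)
  case (rel c u i j v)
  show ?case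
    unfolding smul_rel using assms(2) by (auto simp: lookup_add lookup_smul lookup_single when_def)
qed (simp_all add: lookup_add)

text \<open>
  Both words of a relation have the same length and parity, so a component either keeps the relation
  or drops it.
\<close>

lemma part_ideal:
  assumes "t \<in> ideal"
  shows "part (\<lambda>w. R (length (letters w)) (par_word L x w)) t \<in> ideal" (is "part ?R t \<in> _")
  using assms
proof (induction rule: ideal_induct)
  case (rel c u i j v)
  have "part ?R (smul c (tword u * rel i j * tword v)) =
      (if R (length u + (2 + length v)) (par_word L x (Word (u @ i # j # v)))
       then smul c (tword u * rel i j * tword v) else 0)"
  proof (rule part_homogeneous)
    fix w assume "w \<in> Poly_Mapping.keys (smul c (tword u * rel i j * tword v))"
    then have "w = Word (u @ i # j # v) \<or> w = Word (u @ j # i # v)"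
      unfolding smul_rel
      by (auto simp: in_keys_iff lookup_add lookup_smul lookup_single when_def split: if_splits)
    then show "?R w = R (length u + (2 + length v)) (par_word L x (Word (u @ i # j # v)))"
    proof
      assume "w = Word (u @ j # i # v)"
      moreover have "par_word L x (Word (u @ j # i # v)) = par_word L x (Word (u @ i # j # v))"
        by (simp only: par_word_def word.sel map_append list.map sum_list.append sum_list.Cons add.left_commute)
      ultimately show ?thesis by simp
    qed simp
  qed
  then show ?case
    using ideal_closed(1) ideal_closed(7)[OF ideal_closed(4)[OF ideal_closed(3)[OF rel_in_ideal]]]
    by (cases "R (length u + (2 + length v)) (par_word L x (Word (u @ i # j # v)))") simp_all
qed (simp_all add: part_algebra ideal_closed)

lemma covec_notin_ideal:
  assumes "h \<in> dual L" "h u \<noteq> 0"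
  shows "covec x h \<notin> ideal"
proof
  assume "covec x h \<in> ideal"
  then have "h (x i) = 0" for i
    using ideal_low_degree[of "covec x h" "Word [i]"] by (simp add: lookup_covec)
  then show False using assms dual_expand[OF assms(1), of u] by simp
qed

section \<open>Word lengths in the differential\<close>

lemma part_sum: "part R (\<Sum>i\<in>A. f i) = (\<Sum>i\<in>A. part R (f i))"
  for f :: "'a \<Rightarrow> ('i, 'k) tens"
  by (induction A rule: infinite_finite_induct) (simp_all add: part_algebra)

lemma keys_diff_gen:
  assumes "w \<in> Poly_Mapping.keys (diff_gen L x i)"
  shows "length (letters w) = 2"
proof -
  have "len_part 2 (gen k * gen l) = (gen k * gen l :: ('i, 'k) tens)" for k l :: 'i
    by (subst part_homogeneous[where b = True]) (auto simp: mult_single plus_word_def)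
  then have "len_part 2 (diff_gen L x i) = diff_gen L x i"
    by (simp add: diff_gen_def part_algebra part_sum power2_eq_square)
  then show ?thesis
    using assms lookup_part[of "\<lambda>w. length (letters w) = 2" "diff_gen L x i" w]
    by (auto simp: in_keys_iff split: if_splits)
qed

lemma ext_diff_low_degree:
  assumes "length (letters w) < 2"
  shows "Poly_Mapping.lookup (ext_diff L x t) w = 0"
proof -
  have "2 \<le> length (letters w)" if "w \<in> Poly_Mapping.keys (diff_word L x u)" for u w
    using that
  proof (induction u arbitrary: w)
    case (Cons i u)
    then consider "w \<in> Poly_Mapping.keys (diff_gen L x i * tword u)"
      | "w \<in> Poly_Mapping.keys (gen i * diff_word L x u :: ('i, 'k) tens)"
      using keys_diff[of "diff_gen L x i * tword u" "gen i * diff_word L x u"] by auto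
    then show ?case
    proof cases
      case 1
      then show ?thesis
        by (rule keys_mult_rule) (auto simp: letters_plus keys_diff_gen)
    next
      case 2
      then show ?thesis
        by (rule keys_mult_rule) (use Cons.IH in \<open>force simp: letters_plus\<close>)
    qed
  qed simp
  then have "Poly_Mapping.lookup (diff_word L x u) w = 0" for u
    using assms by (metis in_keys_iff not_less)
  then show ?thesis
    by (simp add: ext_diff_def lookup_sum lookup_smul)
qed

text \<open>
  The coefficient of a one-letter word in a cochain differential comes only from the constant
  parts of the coefficients.
\<close>

lemma lookup_gen_mult:
  "Poly_Mapping.lookup (gen j * t) (Word [k]) = (if j = k then Poly_Mapping.lookup t 0 else 0)"
  for t :: "('i, 'k) tens"
proof (induction t rule: tens_word_induct)
  case (word c u)
  then show ?case
    by (auto simp: mult_smul lookup_smul mult_single plus_word_def lookup_single when_def zero_word_def)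
qed (simp_all add: distrib_left lookup_add)

lemma fun_sum_apply: "(\<Sum>a\<in>A. f a) i = (\<Sum>a\<in>A. f a i)" for f :: "'a \<Rightarrow> ('i, 'k) cochain"
  by (induction A rule: infinite_finite_induct) simp_all

lemma cochain_diff_apply:
  "cochain_diff L x F m =
     (\<Sum>i\<in>UNIV. \<Sum>j\<in>UNIV. smul (coord L x (brk L (x j) (x i)) m * koszul j i) (gen j * F i)) +
     ext_diff L x (F m)"
proof -
  have "smul (coord L x (x i) m) (ext_diff L x (F i)) = (if m = i then ext_diff L x (F i) else 0)" for i
    by (simp add: coord_linear smul_algebra)
  then show ?thesis
    by (simp add: cochain_diff_def fun_sum_apply tensor_def sum.distrib sg_mult_smul smul_algebra koszul_def)
qed

lemma brk_basis_swap: "brk L (x i) (x j) = - scl L (koszul i j) (brk L (x j) (x i))"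
  unfolding koszul_def by (rule skew[OF gr_par gr_par])

text \<open>
  The component in \<open>\<gg> \<otimes> \<And>\<^sup>0\<gg>\<^sup>* = \<gg>\<close>.
\<close>

definition constant_part :: "('i, 'k) cochain \<Rightarrow> 'g" where
  "constant_part F = (\<Sum>j\<in>UNIV. scl L (Poly_Mapping.lookup (F j) 0) (x j))"

text \<open>
  The Koszul sign in the differential turns \<open>[x\<^sub>k, x\<^sub>j]\<close> into \<open>- [x\<^sub>j, x\<^sub>k]\<close>. So in degree \<open>1\<close> the
  differential is a bracket, without any sign that depends on parities.
\<close>

lemma lookup_cochain_diff:
  "Poly_Mapping.lookup (cochain_diff L x F i) (Word [k]) =
    - coord L x (brk L (constant_part F) (x k)) i"
proof -
  have "coord L x (brk L (x k) (x j)) i * koszul k j = - coord L x (brk L (x j) (x k)) i" for j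
  proof -
    have "coord L x (brk L (x k) (x j)) i = - (koszul k j * coord L x (brk L (x j) (x k)) i)"
      by (subst brk_basis_swap) (metis coord_dual coord_linear(2) dualD(3,4) diff_0)
    then show ?thesis
      by (simp add: mult.commute mult.left_commute) (cases "P k"; cases "P j"; simp add: koszul_def sg_def)
  qed
  then show ?thesis
    by (simp add: cochain_diff_apply lookup_add ext_diff_low_degree lookup_sum lookup_smul lookup_gen_mult
      constant_part_def brk_sum brk_linear coord_sum coord_linear sum_negf mult.commute if_distrib[of "\<lambda>t. _ * t"] if_distrib[of "\<lambda>t. t * _"] cong: if_cong)
qed

section \<open>The derived algebra is a line\<close>

lemma derived_eq: "derived L = vs.span {brk L u v |u v. True}"
  by simp

lemma brk_in_derived: "brk L u v \<in> derived L"
  unfolding derived_eq by (rule vs.span_base) blast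

lemma derived_subspace: "vs.subspace (derived L)"
  unfolding derived_eq by (rule vs.subspace_span)

text \<open>
  Nilpotency gives \<open>[u, m] = 0\<close>. For the other order, the Jacobi identity expresses
  \<open>[[x\<^sub>i, x\<^sub>j], w]\<close> by brackets of the first kind.
\<close>

lemma derived_central:
  assumes "lower_central L 2 = {0}" "m \<in> derived L"
  shows "brk L u m = 0" "brk L m u = 0"
proof -
  have right: "brk L u m = 0" if "m \<in> derived L" for u m
  proof -
    have "brk L u m \<in> lower_central L (Suc 1)"
      unfolding lower_central.simps(2)[of L 1] by (rule vs.span_base) (use that in blast)
    then show ?thesis using assms(1) by (simp add: numeral_2_eq_2)
  qed
  then show "brk L u m = 0" using assms(2) .
  have "brk L (brk L (x i) (x j)) w = 0" for i j w
    using jacobi[OF gr_par gr_par, of i j w] right[OF brk_in_derived] by simp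
  then have "brk L (brk L (\<Sum>i\<in>UNIV. scl L (a i) (x i)) (\<Sum>j\<in>UNIV. scl L (b j) (x j))) w = 0" for a b w
    by (simp add: brk_sum brk_linear)
  then have "brk L (brk L a b) w = 0" for a b w
    by (metis sum_coord)
  moreover have "vs.subspace {m. brk L m u = 0}"
    by (rule vs.subspaceI) (simp_all add: brk_linear)
  ultimately have "derived L \<subseteq> {m. brk L m u = 0}"
    unfolding derived_eq by (intro vs.span_minimal) auto
  then show "brk L m u = 0" using assms(2) by blast
qed

lemma tensor_mem_space: "m \<in> U \<Longrightarrow> t \<in> T \<Longrightarrow> tensor L x m t \<in> tensor_space L x U T"
proof -
  assume "m \<in> U" "t \<in> T"
  interpret cochains: module "\<lambda>c (F :: ('i, 'k) cochain) i. smul c (F i)"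
    by standard (simp_all add: fun_eq_iff smul_algebra)
  show ?thesis
    unfolding tensor_space_def by (rule cochains.span_base) (use \<open>m \<in> U\<close> \<open>t \<in> T\<close> in blast)
qed

text \<open>
  Compare the coefficients of the one-letter words in \<open>m \<otimes> h = dF + N\<close>: the left side gives
  \<open>h(x\<^sub>k) m\<close>, the right side a bracket with the constant part of \<open>F\<close>.
\<close>

lemma bracket_realizes:
  assumes cob: "tensor_space L x (derived L) (ext_power x (annihilator L (derived L)) 1) \<subseteq> coboundaries L x"
    and m: "m \<in> derived L" and h: "h \<in> annihilator L (derived L)"
  obtains c where "\<And>u. brk L c u = scl L (h u) m"
proof -
  have hd: "h \<in> dual L" using h by (simp add: annihilator_def)
  have "covec x h = prod_list (map (covec x) [h])" by simp
  then have "covec x h \<in> ext_power x (annihilator L (derived L)) 1"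
    unfolding ext_power_def by (intro tens.span_base) (use h in \<open>intro CollectI exI[of _ "[h]"], simp\<close>)
  then have "tensor L x m (covec x h) \<in> coboundaries L x"
    using cob m tensor_mem_space by blast
  then obtain F N where FN: "tensor L x m (covec x h) = cochain_diff L x F + N"
    and N: "N \<in> null_cochains L x"
    unfolding coboundaries_def by (auto simp: set_plus_def)
  define c where "c = - constant_part F"
  have "brk L c (x k) = scl L (h (x k)) m" for k
  proof (rule vec_eqI)
    fix i
    have "coord L x (brk L c (x k)) i = Poly_Mapping.lookup (cochain_diff L x F i) (Word [k])"
      unfolding lookup_cochain_diff c_def
      by (metis add.inverse_inverse brk_linear(2,6) add_eq_0_iff coord_linear(1,3))
    also have "\<dots> = Poly_Mapping.lookup (tensor L x m (covec x h) i) (Word [k])"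
      using N by (simp add: FN lookup_add null_cochains_def ideal_low_degree)
    also have "\<dots> = coord L x (scl L (h (x k)) m) i"
      by (simp add: tensor_def lookup_smul lookup_covec coord_linear)
    finally show "coord L x (brk L c (x k)) i = coord L x (scl L (h (x k)) m) i" .
  qed
  then have "brk L c (\<Sum>k\<in>UNIV. scl L (a k) (x k)) = scl L (h (\<Sum>k\<in>UNIV. scl L (a k) (x k))) m" for a
    by (simp add: brk_sum brk_linear dualD[OF hd] vs.scale_sum_left)
  then have "brk L c u = scl L (h u) m" for u
    by (metis sum_coord)
  then show ?thesis by (rule that)
qed

lemma dual_gr_sub_dual: "h \<in> dual_gr L p \<Longrightarrow> h \<in> dual L"
  by (simp add: dual_gr_def)

text \<open>
  A homogeneous \<open>\<alpha>\<close> sees of \<open>[x\<^sub>j, c]\<close> only the component of \<open>c\<close> of one parity, so all signs that occur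
  are equal. It follows that left orthogonality for \<open>\<omega>\<close> implies right orthogonality, even
  for inhomogeneous \<open>c\<close>.
\<close>

lemma form_symmetric:
  assumes "\<alpha> \<in> dual_gr L p"
  shows "\<alpha> (brk L (x j) c) = - sg (P j * (p + P j)) * \<alpha> (brk L c (x j))"
proof -
  note \<alpha> = dualD[OF dual_gr_sub_dual[OF assms]]
  have "\<alpha> (brk L (x j) (x i)) = - sg (P j * (p + P j)) * \<alpha> (brk L (x i) (x j))" for i
  proof (cases "P j + P i = p")
    case True
    then have "P i = p + P j" by (cases p; cases "P i"; cases "P j") simp_all
    moreover have "\<alpha> (- u) = - \<alpha> u" for u using \<alpha>(4)[of 0 u] \<alpha>(3) by simp
    ultimately show ?thesis
      by (subst brk_basis_swap) (simp only: \<alpha>(2) koszul_def mult_minus_left)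
  next
    case False
    then have "P j + P i = p + 1" "P i + P j = p + 1" by (cases p; cases "P i"; cases "P j"; simp)+
    then have "brk L (x j) (x i) \<in> gr L (p + 1)" "brk L (x i) (x j) \<in> gr L (p + 1)"
      using brk_gr[OF gr_par gr_par] by metis+
    then show ?thesis using assms by (simp add: dual_gr_def)
  qed
  then have "\<alpha> (brk L (x j) (\<Sum>i\<in>UNIV. scl L (a i) (x i))) =
      - sg (P j * (p + P j)) * \<alpha> (brk L (\<Sum>i\<in>UNIV. scl L (a i) (x i)) (x j))" for a
    by (simp only: brk_sum brk_linear \<alpha> sum_distrib_left mult.left_commute)
  then show ?thesis by (metis sum_coord)
qed

text \<open>
  The core of the reduction: elements of \<open>[\<gg>, \<gg>]\<close> killed by \<open>\<alpha>\<close> vanish (fact \<open>inj\<close> in the proof),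
  because the bracket realises too many maps \<open>u \<mapsto> h(u) m\<close>.
\<close>

lemma derived_line:
  assumes two_step: "two_step_nilpotent L"
    and cob: "tensor_space L x (derived L) (ext_power x (annihilator L (derived L)) 1) \<subseteq> coboundaries L x"
  obtains z p \<alpha> where "z \<in> gr L p" "\<alpha> \<in> dual_gr L p" "\<alpha> z = 1"
    "\<And>u v. brk L u v = scl L (\<alpha> (brk L u v)) z"
    "\<And>u. brk L z u = 0" "\<And>u. brk L u z = 0" "z \<in> derived L"
proof -
  have central: "brk L u m = 0" "brk L m u = 0" if "m \<in> derived L" for u m
    using derived_central[OF _ that] two_step by (simp_all add: two_step_nilpotent_def)
  have "\<exists>k l. brk L (x k) (x l) \<noteq> 0"
  proof (rule ccontr)
    assume "\<not> ?thesis"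
    then have "brk L (\<Sum>i\<in>UNIV. scl L (a i) (x i)) (\<Sum>j\<in>UNIV. scl L (b j) (x j)) = 0" for a b
      by (simp add: brk_sum brk_linear)
    then have "brk L u v = 0" for u v
      by (metis sum_coord)
    then have "derived L = {0}"
      by (simp add: vs.span_eq_iff)
    then show False using two_step by (simp add: two_step_nilpotent_def)
  qed
  then obtain k l where kl: "brk L (x k) (x l) \<noteq> 0" by blast
  define z where "z = brk L (x k) (x l)"
  define p where "p = P k + P l"
  have z: "z \<in> gr L p" "z \<in> derived L"
    unfolding z_def p_def by (rule brk_gr[OF gr_par gr_par] brk_in_derived)+
  obtain i where i: "coord L x z i \<noteq> 0"
    using kl vec_eqI[of z 0] by (auto simp: z_def coord_linear)
  \<comment> \<open>A normalised coordinate functional is homogeneous, of the parity of \<open>z\<close>.\<close>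
  define \<alpha> where "\<alpha> = (\<lambda>u. coord L x u i / coord L x z i)"
  have "P i = p" using coord_gr[OF z(1)] i by blast
  have "\<alpha> \<in> dual L"
    unfolding \<alpha>_def by (rule dualI) (simp_all add: coord_linear add_divide_distrib)
  then have \<alpha>: "\<alpha> \<in> dual_gr L p"
    using coord_dual_gr[of i] \<open>P i = p\<close> by (simp add: dual_gr_def \<alpha>_def)
  note \<alpha>_lin = dualD[OF \<open>\<alpha> \<in> dual L\<close>]
  have \<alpha>z: "\<alpha> z = 1" using i by (simp add: \<alpha>_def)
  have "x k \<notin> derived L"
    using central kl by blast
  then obtain h where h: "h \<in> annihilator L (derived L)" "h (x k) = 1"
    using separate[OF derived_subspace] by blast
  have inj: "m = 0" if m: "m \<in> derived L" "\<alpha> m = 0" for m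
  proof -
    obtain c where c: "\<And>u. brk L c u = scl L (h u) m"
      using bracket_realizes[OF cob m(1) h(1)] by blast
    have "\<alpha> (brk L (x j) c) = 0" for j
      unfolding form_symmetric[OF \<alpha>] c using m by (simp add: \<alpha>_lin)
    then have "\<alpha> (brk L (\<Sum>j\<in>UNIV. scl L (a j) (x j)) c) = 0" for a
      by (simp add: brk_sum brk_linear \<alpha>_lin)
    then have orth: "\<alpha> (brk L u c) = 0" for u
      by (metis sum_coord)
    have "h' c = 0" if h': "h' \<in> annihilator L (derived L)" for h'
    proof -
      obtain c' where "\<And>u. brk L c' u = scl L (h' u) z"
        using bracket_realizes[OF cob z(2) h'] by blast
      then show ?thesis using orth[of c'] by (simp add: \<alpha>_lin \<alpha>z)
    qed
    then have "c \<in> derived L"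
      using separate[OF derived_subspace, of c] by (metis zero_neq_one)
    then show ?thesis
      using c[of "x k"] h(2) central(2)[of c "x k"] by simp
  qed
  have "brk L u v = scl L (\<alpha> (brk L u v)) z" for u v
  proof -
    have "brk L u v - scl L (\<alpha> (brk L u v)) z \<in> derived L"
      by (intro vs.subspace_diff vs.subspace_scale derived_subspace brk_in_derived z(2))
    then show ?thesis
      using inj[of "brk L u v - scl L (\<alpha> (brk L u v)) z"] by (simp add: \<alpha>_lin \<alpha>z)
  qed
  then show ?thesis using that[of z p \<alpha>] z \<alpha> \<alpha>z central by blast
qed

end

section \<open>One-dimensional derived algebra\<close>

lemma sg_add_one: "sg (p + 1) = - (sg p :: 'a::ring_1)"
  by (cases p) (simp_all add: sg_def)

text \<open>
  The situation reached by \<open>derived_line\<close>: the bracket is \<open>\<omega>(u, v) z\<close> for a bilinear form \<open>\<omega>\<close>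
  and a central element \<open>z\<close>.
\<close>

locale line_superalgebra = based_superalgebra L x
  for L :: "('k::field_char_0, 'g::ab_group_add) superalg"
    and x :: "'i::{finite, linorder} \<Rightarrow> 'g" +
  fixes z :: 'g and p :: bit and \<alpha> :: "'g \<Rightarrow> 'k"
  assumes z_gr: "z \<in> gr L p"
    and \<alpha>_gr: "\<alpha> \<in> dual_gr L p"
    and \<alpha>_z: "\<alpha> z = 1"
    and brk_line: "brk L u v = scl L (\<alpha> (brk L u v)) z"
    and central: "brk L z u = 0" "brk L u z = 0"
    and z_derived: "z \<in> derived L"
begin

abbreviation "\<omega> u v \<equiv> \<alpha> (brk L u v)"
abbreviation "zc \<equiv> coord L x z"
abbreviation "\<phi> \<equiv> covec x \<alpha>"

text \<open>
  This is \<open>V\<^sup>*\<close>, regarded as a subspace of \<open>\<gg>\<^sup>*\<close>.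
\<close>

definition horizontal_dual :: "('g \<Rightarrow> 'k) set" where
  "horizontal_dual = annihilator L (derived L)"

lemma \<alpha>_dual: "\<alpha> \<in> dual L" by (rule dual_gr_sub_dual[OF \<alpha>_gr])
lemmas \<alpha>_lin = dualD[OF \<alpha>_dual]

lemma annihilator_derivedI:
  assumes "h \<in> dual L" "\<And>u v. h (brk L u v) = 0"
  shows "h \<in> horizontal_dual"
proof -
  have "vs.subspace {u. h u = 0}"
    by (rule vs.subspaceI) (simp_all add: dualD[OF assms(1)])
  then have "derived L \<subseteq> {u. h u = 0}"
    unfolding derived_eq by (intro vs.span_minimal) (auto simp: assms(2))
  then show ?thesis using assms(1) by (auto simp: horizontal_dual_def annihilator_def)
qed

lemma coord_brk: "coord L x (brk L u v) i = \<omega> u v * zc i"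
  by (subst brk_line) (simp add: coord_linear)

lemma \<omega>_parity: "\<omega> (x k) (x l) \<noteq> 0 \<Longrightarrow> P k + P l = p"
proof (rule ccontr)
  assume *: "\<omega> (x k) (x l) \<noteq> 0" "P k + P l \<noteq> p"
  then have "P k + P l = p + 1" by (cases p; cases "P k"; cases "P l") simp_all
  then have "brk L (x k) (x l) \<in> gr L (p + 1)"
    using brk_gr[OF gr_par gr_par, of k l] by simp
  then show False using *(1) \<alpha>_gr by (simp add: dual_gr_def)
qed

lemma zc_parity: "zc i \<noteq> 0 \<Longrightarrow> P i = p"
  using coord_gr[OF z_gr] by blast

text \<open>
  The form \<open>\<omega>\<close> as an element of \<open>\<And>\<^sup>2\<gg>\<^sup>*\<close>. Every differential of a covector is a multiple of it.
\<close>

definition Omega :: "('i, 'k) tens" where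
  "Omega = (\<Sum>l\<in>UNIV. \<Sum>k | k < l. smul (- koszul k l * \<omega> (x k) (x l)) (gen k * gen l)) +
     smul (1 / 2) (\<Sum>k\<in>UNIV. smul (\<omega> (x k) (x k)) (gen k * gen k))"

lemma diff_gen_eq: "diff_gen L x i = smul (zc i) Omega"
  unfolding diff_gen_def Omega_def sg_add_one koszul_def[symmetric] coord_brk
  by (simp add: smul_algebra smul_sum power2_eq_square mult.commute mult.left_commute)

lemma ext_diff_sum: "ext_diff L x (\<Sum>i\<in>A. f i) = (\<Sum>i\<in>A. ext_diff L x (f i))"
  by (induction A rule: infinite_finite_induct) (simp_all add: ext_diff_add, simp_all add: ext_diff_def)

lemma ext_diff_linear: "ext_diff L x 0 = 0" "ext_diff L x (s - t) = ext_diff L x s - ext_diff L x t"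
proof -
  show "ext_diff L x 0 = 0" by (simp add: ext_diff_def)
  show "ext_diff L x (s - t) = ext_diff L x s - ext_diff L x t"
    using ext_diff_add[of L x "s - t" t] by (simp add: algebra_simps)
qed

lemma ext_diff_covec:
  assumes "h \<in> dual L"
  shows "ext_diff L x (covec x h) = smul (h z) Omega"
proof -
  have "ext_diff L x (covec x h) = (\<Sum>i\<in>UNIV. smul (zc i * h (x i)) Omega)"
    by (simp add: covec_def ext_diff_sum ext_diff_smul ext_diff_gen diff_gen_eq smul_algebra mult.commute)
  then show ?thesis
    by (simp add: sum_smul[symmetric] dual_expand[OF assms, of z])
qed

text \<open>
  Only products of two basis covectors whose parities add up to that of \<open>z\<close> occur in \<open>Omega\<close>.
\<close>

lemma Omega_induct [case_names zero add quad]: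
  assumes zero: "Q 0" and add: "\<And>s t. Q s \<Longrightarrow> Q t \<Longrightarrow> Q (s + t)"
    and quad: "\<And>c k l. P k + P l = p \<Longrightarrow> Q (smul c (gen k * gen l))"
  shows "Q Omega"
proof -
  have sum: "Q (\<Sum>i\<in>A. f i)" if "\<And>i. i \<in> A \<Longrightarrow> Q (f i)" for A and f :: "'i \<Rightarrow> ('i, 'k) tens"
    using that by (induction A rule: infinite_finite_induct) (simp_all add: zero add)
  have "Q (smul (c * \<omega> (x k) (x l)) (gen k * gen l))" for c k l
    using quad \<omega>_parity by (cases "\<omega> (x k) (x l) = 0") (simp_all add: smul_algebra zero)
  then show ?thesis
    unfolding Omega_def smul_sum smul_algebra(4) by (intro add sum)
qed

lemma keys_Omega:
  assumes "w \<in> Poly_Mapping.keys Omega"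
  shows "length (letters w) = 2"
proof -
  have "len_part 2 Omega = Omega"
  proof (induction rule: Omega_induct)
    case (quad c k l)
    show ?case
      by (subst part_homogeneous[where b = True]) (auto simp: mult_single plus_word_def dest!: keys_smul)
  qed (simp_all add: part_algebra)
  then show ?thesis
    using assms lookup_part[of "\<lambda>w. length (letters w) = 2" Omega w]
    by (auto simp: in_keys_iff split: if_splits)
qed

section \<open>Horizontal forms\<close>

text \<open>
  The basis \<open>x\<close> need not be adapted to \<open>\<gg> = V \<oplus> [\<gg>, \<gg>]\<close>. The functionals \<open>eps i\<close> are the
  coordinate functionals made to vanish on \<open>z\<close> by subtracting a multiple of \<open>\<alpha>\<close>. They span \<open>V\<^sup>*\<close>,
  are linearly dependent, and each is homogeneous of the parity of \<open>x i\<close>.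
\<close>

definition eps :: "'i \<Rightarrow> 'g \<Rightarrow> 'k" where
  "eps i u = coord L x u i - zc i * \<alpha> u"

abbreviation "e i \<equiv> covec x (eps i)"

lemma eps_z: "eps i z = 0"
  by (simp add: eps_def \<alpha>_z)

lemma eps_dual: "eps i \<in> dual L"
  by (rule dualI) (simp_all add: eps_def coord_linear \<alpha>_lin algebra_simps)

lemma eps_gr: "eps i \<in> dual_gr L (P i)"
  using eps_dual coord_dual_gr[of i] \<alpha>_gr zc_parity[of i]
  by (cases "zc i = 0") (auto simp: dual_gr_def eps_def)

lemma eps_horizontal: "eps i \<in> horizontal_dual"
proof (rule annihilator_derivedI[OF eps_dual])
  show "eps i (brk L u v) = 0" for u v
    by (subst brk_line) (simp add: dualD[OF eps_dual] eps_z)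
qed

lemma e_eq: "e i = gen i - smul (zc i) \<phi>"
proof -
  have "e i = covec x (\<lambda>u. coord L x u i) - smul (zc i) \<phi>"
    by (simp add: covec_def eps_def smul_algebra smul_sum sum_subtractf tens.scale_left_diff_distrib)
  then show ?thesis by (simp add: covec_coord)
qed

lemma par_word_single: "par_word L x (Word [j]) = P j"
  by (simp only: par_word_def word.sel list.map sum_list.Cons sum_list.Nil add_0_right)

lemma keys_covec:
  assumes "h \<in> dual_gr L q" "w \<in> Poly_Mapping.keys (covec x h)"
  shows "length (letters w) = 1" "par_word L x w = q"
proof -
  have "length (letters w) = 1 \<and> par_word L x w = q"
  proof (rule ccontr)
    assume contra: "\<not> ?thesis"
    have zero: "h (x j) * Poly_Mapping.lookup (gen j) w = 0" for j
      using contra dual_gr_basis[OF assms(1), of j]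
      by (cases "h (x j) = 0") (auto simp: lookup_single when_def par_word_single)
    then show False
      using assms(2) by (simp only: in_keys_iff covec_def lookup_sum lookup_smul zero sum.neutral_const simp_thms)
  qed
  then show "length (letters w) = 1" "par_word L x w = q" by auto
qed

definition eword :: "'i list \<Rightarrow> ('i, 'k) tens" where
  "eword us = prod_list (map e us)"

lemma keys_eword:
  assumes "w \<in> Poly_Mapping.keys (eword us)"
  shows "length (letters w) = length us" "par_word L x w = sum_list (map P us)"
proof -
  have "length (letters w) = length us \<and> par_word L x w = sum_list (map P us)"
    using assms
  proof (induction us arbitrary: w)
    case Nil
    then show ?case by (simp add: eword_def zero_word_def par_word_def)
  next
    case (Cons i us)
    then have "w \<in> Poly_Mapping.keys (e i * eword us)" by (simp add: eword_def)
    then obtain u v where w: "w = u + v" "u \<in> Poly_Mapping.keys (e i)" "v \<in> Poly_Mapping.keys (eword us)"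
      by (rule keys_mult_rule)
    have "length (letters w) = length (i # us)"
      using keys_covec[OF eps_gr w(2)] Cons.IH[OF w(3)] by (simp add: w(1) letters_plus)
    moreover have "par_word L x w = sum_list (map P (i # us))"
      using keys_covec[OF eps_gr w(2)] Cons.IH[OF w(3)]
      by (simp only: w(1) par_word_def letters_plus map_append sum_list.append list.map sum_list.Cons)
    ultimately show ?case ..
  qed
  then show "length (letters w) = length us" "par_word L x w = sum_list (map P us)" by auto
qed

text \<open>
  Representatives of \<open>\<And>V\<^sup>*\<close>. Taking homogeneous generators makes the closure under components
  of a given length and parity immediate.
\<close>

definition horizontal :: "('i, 'k) tens set" where
  "horizontal = tens.span (range eword)"

lemma horizontal_closed:
  shows "0 \<in> horizontal" "s \<in> horizontal \<Longrightarrow> t \<in> horizontal \<Longrightarrow> s + t \<in> horizontal"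
    "s \<in> horizontal \<Longrightarrow> t \<in> horizontal \<Longrightarrow> s - t \<in> horizontal"
    "t \<in> horizontal \<Longrightarrow> smul c t \<in> horizontal" "eword us \<in> horizontal"
  unfolding horizontal_def
  by (auto intro: tens.span_zero tens.span_add tens.span_diff tens.span_scale tens.span_base)

lemma horizontal_one: "1 \<in> horizontal"
  using horizontal_closed(5)[of "[]"] by (simp add: eword_def)

lemma horizontal_e: "e i \<in> horizontal"
  using horizontal_closed(5)[of "[i]"] by (simp add: eword_def)

lemma horizontal_least:
  assumes "Q 0" "\<And>s t. Q s \<Longrightarrow> Q t \<Longrightarrow> Q (s + t)" "\<And>c t. Q t \<Longrightarrow> Q (smul c t)" "\<And>us. Q (eword us)"
    and "t \<in> horizontal"
  shows "Q t"
proof -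
  have "tens.subspace {t. Q t}"
    using assms(1-3) by (auto intro: tens.subspaceI)
  then have "horizontal \<subseteq> {t. Q t}"
    unfolding horizontal_def using assms(4) by (intro tens.span_minimal) auto
  then show ?thesis using assms(5) by blast
qed

lemma horizontal_mult:
  assumes "s \<in> horizontal" "t \<in> horizontal"
  shows "s * t \<in> horizontal"
proof -
  have "eword us * t \<in> horizontal" for us
  proof (rule horizontal_least[OF _ _ _ _ assms(2)])
    show "eword us * eword vs \<in> horizontal" for vs
      using horizontal_closed(5)[of "us @ vs"] by (simp add: eword_def)
  qed (simp_all add: distrib_left mult_smul horizontal_closed)
  then show ?thesis
    by (intro horizontal_least[OF _ _ _ _ assms(1), of "\<lambda>s. s * t \<in> horizontal"])
      (simp_all add: distrib_right smul_algebra(8) horizontal_closed)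
qed

lemma part_eword:
  "part (\<lambda>w. R (length (letters w)) (par_word L x w)) (eword us) =
    (if R (length us) (sum_list (map P us)) then eword us else 0)"
  by (rule part_homogeneous) (simp add: keys_eword)

lemma part_horizontal:
  assumes "t \<in> horizontal"
  shows "part (\<lambda>w. R (length (letters w)) (par_word L x w)) t \<in> horizontal"
  by (rule horizontal_least[OF _ _ _ _ assms])
    (simp_all add: part_algebra part_eword horizontal_closed)

lemma len_part_horizontal:
  assumes "t \<in> horizontal"
  shows "len_part k t \<in> ext_power x horizontal_dual k"
proof (rule horizontal_least[OF _ _ _ _ assms])
  fix us
  have "eword us \<in> ext_power x horizontal_dual (length us)"
    unfolding ext_power_def
    by (rule tens.span_base, intro CollectI exI[of _ "map eps us"])
      (auto simp: eword_def eps_horizontal comp_def)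
  then show "len_part k (eword us) \<in> ext_power x horizontal_dual k"
    using part_eword[of "\<lambda>n _. n = k"] by (auto simp: ext_power_def tens.span_zero)
qed (auto simp: part_algebra ext_power_def intro: tens.span_zero tens.span_add tens.span_scale)

text \<open>
  Functionals that kill brackets have differential zero, already as tensors.
\<close>

lemma ext_diff_horizontal:
  assumes "t \<in> horizontal"
  shows "ext_diff L x t = 0"
proof (rule horizontal_least[OF _ _ _ _ assms])
  show "ext_diff L x (eword us) = 0" for us
  proof (induction us)
    case Nil
    show ?case
      using ext_diff_single[of L x "Word []" 1] by (simp add: eword_def tword_Nil smul_algebra)
  next
    case (Cons i us)
    have "ext_diff L x (e i) = 0"
      by (simp add: ext_diff_covec[OF eps_dual] eps_z smul_algebra)
    moreover have "\<forall>w\<in>Poly_Mapping.keys (e i). length (letters w) = 1"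
      using keys_covec(1)[OF eps_gr] by blast
    ultimately have "ext_diff L x (e i * eword us) = 0"
      using ext_diff_mult[of "e i" 1 L x "eword us"] Cons.IH by simp
    then show ?case by (simp add: eword_def)
  qed
qed (simp_all add: ext_diff_add ext_diff_smul ext_diff_linear smul_algebra)

text \<open>
  The tensors whose class in \<open>\<And>\<gg>\<^sup>*\<close> lies in \<open>\<And>V\<^sup>*\<close>.
\<close>

definition horizontal_mod :: "('i, 'k) tens set" where
  "horizontal_mod = {t. \<exists>a\<in>horizontal. t - a \<in> ideal}"

lemma horizontal_modI: "a \<in> horizontal \<Longrightarrow> t - a \<in> ideal \<Longrightarrow> t \<in> horizontal_mod"
  by (auto simp: horizontal_mod_def)

lemma horizontal_mod_closed:
  shows "a \<in> horizontal \<Longrightarrow> a \<in> horizontal_mod" "t \<in> ideal \<Longrightarrow> t \<in> horizontal_mod"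
    "s \<in> horizontal_mod \<Longrightarrow> t \<in> horizontal_mod \<Longrightarrow> s + t \<in> horizontal_mod"
    "s \<in> horizontal_mod \<Longrightarrow> t \<in> horizontal_mod \<Longrightarrow> s * t \<in> horizontal_mod"
    "s \<in> horizontal_mod \<Longrightarrow> smul c s \<in> horizontal_mod"
    "s \<in> horizontal_mod \<Longrightarrow> part (\<lambda>w. R (length (letters w)) (par_word L x w)) s \<in> horizontal_mod"
proof -
  show "a \<in> horizontal \<Longrightarrow> a \<in> horizontal_mod"
    by (rule horizontal_modI[of a]) (simp_all add: ideal_closed(1))
  show "t \<in> ideal \<Longrightarrow> t \<in> horizontal_mod"
    by (rule horizontal_modI[OF horizontal_closed(1)]) simp
  assume s: "s \<in> horizontal_mod"
  then obtain a where a: "a \<in> horizontal" "s - a \<in> ideal"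
    by (auto simp: horizontal_mod_def)
  have "smul c s - smul c a \<in> ideal"
    using ideal_closed(7)[OF a(2), of c] by (simp add: smul_algebra)
  then show "smul c s \<in> horizontal_mod"
    by (rule horizontal_modI[OF horizontal_closed(4)[OF a(1)]])
  let ?R = "\<lambda>w. R (length (letters w)) (par_word L x w)"
  have "part ?R s - part ?R a \<in> ideal"
    using part_ideal[OF a(2), of R] by (simp add: part_algebra)
  then show "part ?R s \<in> horizontal_mod"
    by (rule horizontal_modI[OF part_horizontal[OF a(1)]])
  assume "t \<in> horizontal_mod"
  then obtain b where b: "b \<in> horizontal" "t - b \<in> ideal"
    by (auto simp: horizontal_mod_def)
  have eq: "s + t - (a + b) = (s - a) + (t - b)" "s * t - a * b = (s - a) * t + a * (t - b)"
    by (simp_all add: algebra_simps)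
  then show "s + t \<in> horizontal_mod" "s * t \<in> horizontal_mod"
    using horizontal_modI[OF horizontal_closed(2)[OF a(1) b(1)], of "s + t", unfolded eq]
      horizontal_modI[OF horizontal_mult[OF a(1) b(1)], of "s * t", unfolded eq]
      ideal_closed(2)[OF a(2) b(2)] ideal_closed(2)[OF ideal_closed(4)[OF a(2)] ideal_closed(3)[OF b(2)]]
    by blast+
qed

lemma horizontal_mod_sum: "(\<And>i. i \<in> A \<Longrightarrow> f i \<in> horizontal_mod) \<Longrightarrow> (\<Sum>i\<in>A. f i) \<in> horizontal_mod"
  by (induction A rule: infinite_finite_induct)
    (simp_all add: horizontal_mod_closed(3) horizontal_mod_closed(2)[OF ideal_closed(1)])

end

section \<open>Non-degeneracy\<close>

text \<open>
  Condition (2), applied to the functional \<open>f\<close> with \<open>f(z) = 1\<close> that vanishes on \<open>V\<close>; its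
  differential is \<open>Omega\<close>.
\<close>

locale regular_superalgebra = line_superalgebra L x z p \<alpha>
  for L :: "('k::field_char_0, 'g::ab_group_add) superalg"
    and x :: "'i::{finite, linorder} \<Rightarrow> 'g" and z p \<alpha> +
  assumes regular: "k \<ge> 1 \<Longrightarrow> g \<in> ext_power x horizontal_dual k \<Longrightarrow> Omega * g \<in> ideal \<Longrightarrow> g \<in> ideal"
begin

text \<open>
  If \<open>V\<^sup>* = 0\<close>, then every element is a multiple of the central element \<open>z\<close>, and \<open>\<gg>\<close> is abelian.
\<close>

lemma exists_e_notin_ideal: "\<exists>i. e i \<notin> ideal"
proof (rule ccontr)
  assume "\<not> ?thesis"
  then have eps_zero: "eps i u = 0" for i u
    using covec_notin_ideal[OF eps_dual] by blast
  have "u = scl L (\<alpha> u) z" for u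
  proof (rule vec_eqI)
    show "coord L x u i = coord L x (scl L (\<alpha> u) z) i" for i
      using eps_zero[of i u] unfolding eps_def coord_linear by (simp only: right_minus_eq mult.commute)
  qed
  then have "brk L u v = 0" for u v
    using central(1) brk_linear(4) vs.scale_zero_right by metis
  then have "\<alpha> \<in> horizontal_dual"
    by (intro annihilator_derivedI) (simp_all add: \<alpha>_dual \<alpha>_lin)
  then show False
    using z_derived \<alpha>_z by (auto simp: horizontal_dual_def annihilator_def)
qed

lemma Omega_notin_ideal: "Omega \<notin> ideal"
proof
  assume "Omega \<in> ideal"
  moreover have "e i \<in> ext_power x horizontal_dual 1" for i
    using len_part_horizontal[OF horizontal_e, of 1 i] keys_covec(1)[OF eps_gr, of _ i]
      part_homogeneous[of "e i" "\<lambda>w. length (letters w) = 1" True] by simp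
  ultimately have "e i \<in> ideal" for i
    using regular[of 1 "e i"] ideal_closed(4) by simp
  then show False using exists_e_notin_ideal by blast
qed

text \<open>
  \<open>Omega\<close> is homogeneous, so the homogeneous components of \<open>g\<close> can be treated one by one. In
  degree \<open>0\<close>, which condition (2) does not cover, the claim is that \<open>Omega\<close> itself is not zero in
  \<open>\<And>\<gg>\<^sup>*\<close>: otherwise condition (2) in degree \<open>1\<close> would kill \<open>V\<^sup>*\<close>.
\<close>

lemma Omega_regular:
  assumes g: "g \<in> horizontal" "Omega * g \<in> ideal"
  shows "g \<in> ideal"
proof -
  obtain N where N: "g = (\<Sum>k\<le>N. len_part k g)"
    by (rule len_part_decomposition)
  have "len_part k g \<in> ideal" for k
  proof -
    have "len_part (k + 2) (Omega * g) = Omega * len_part k g"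
      by (rule part_mult) (auto simp: letters_plus dest: keys_Omega)
    then have in_ideal: "Omega * len_part k g \<in> ideal"
      using part_ideal[OF g(2), of "\<lambda>n _. n = k + 2"] by simp
    show ?thesis
    proof (cases "k = 0")
      case True
      define c where "c = Poly_Mapping.lookup g 0"
      have g0: "len_part k g = smul c 1"
        unfolding True len_part_0 c_def by (rule refl)
      then have "smul c Omega \<in> ideal"
        using in_ideal by (simp add: mult_smul)
      then have "smul (1 / c) (smul c Omega) \<in> ideal"
        by (rule ideal_closed(7))
      then have "c = 0"
        using Omega_notin_ideal by (cases "c = 0") (simp_all add: smul_algebra)
      then show ?thesis by (simp add: g0 smul_algebra ideal_closed(1))
    next
      case False
      then show ?thesis
        using regular[OF _ len_part_horizontal[OF g(1)] in_ideal] by simp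
    qed
  qed
  then have "(\<Sum>k\<le>N. len_part k g) \<in> ideal" by (intro ideal_sum)
  then show ?thesis using N by simp
qed

text \<open>
  Move the first copy of the even letter next to the second, where it squares to zero.
\<close>

lemma even_repeated_in_ideal:
  assumes "P i = 0"
  shows "tword (i # b @ [i]) \<in> ideal"
proof (induction b)
  case Nil
  have "koszul i i = 1" using assms by (simp add: koszul_def sg_def)
  then have "gen i * gen i + gen i * gen i \<in> ideal"
    using rel_in_ideal[of i i] by (simp add: smul_algebra)
  then have "gen i * gen i \<in> ideal" by (rule ideal_half)
  then show ?case by (simp add: tword_Cons_Cons tword_Nil)
next
  case (Cons j b)
  have *: "tword (i # (j # b) @ [i]) =
      rel i j * tword (b @ [i]) - smul (koszul i j) (gen j * tword (i # b @ [i]))"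
    by (simp add: tword_Cons_Cons tword_Cons[of i "b @ [i]"] distrib_right smul_algebra(8) mult.assoc)
  show ?case unfolding *
    by (intro ideal_closed(6) ideal_closed(7) ideal_closed(3)[OF Cons.IH] ideal_closed(4)[OF rel_in_ideal])
qed

text \<open>
  For odd \<open>z\<close>, the even basis covectors lie in \<open>V\<^sup>*\<close>, and every term of \<open>Omega\<close> has
  an even factor. A product of even covectors that is non-zero and of maximal length is therefore
  annihilated by \<open>Omega\<close>. Choosing it by maximality avoids having to know that the top exterior power
  is not zero.
\<close>

lemma center_even: "p = 0"
proof (rule ccontr)
  assume "p \<noteq> 0"
  then have p: "p = 1" by simp
  \<comment> \<open>A non-zero product of even covectors has no repeated factor, so its length is bounded.\<close>
  define A where "A us \<longleftrightarrow> (\<forall>i\<in>set us. P i = 0) \<and> tword us \<notin> ideal" for us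
  have "(1 :: ('i, 'k) tens) \<notin> ideal"
    using ideal_low_degree[of 1 0] by (auto simp: zero_word_def lookup_one)
  then have nil: "A []" by (simp add: A_def tword_Nil)
  have bound: "length us \<le> card (UNIV :: 'i set)" if "A us" for us
  proof -
    have "distinct us"
    proof (rule ccontr)
      assume "\<not> distinct us"
      then obtain a i b c where us: "us = a @ [i] @ b @ [i] @ c"
        using not_distinct_decomp by blast
      then have "tword us = tword a * tword (i # b @ [i]) * tword c"
        by (simp add: mult_single plus_word_def)
      moreover have "P i = 0" using that us by (simp add: A_def)
      ultimately have "tword us \<in> ideal"
        by (metis even_repeated_in_ideal ideal_closed(3,4))
      then show False using that by (simp add: A_def)
    qed
    then show ?thesis
      using distinct_card[of us] card_mono[of UNIV "set us"] by simp
  qed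
  obtain us where us: "A us" and max: "\<And>vs. A vs \<Longrightarrow> length vs \<le> length us"
    using ex_has_greatest_nat[of A "[]" length "Suc (card (UNIV :: 'i set))", OF nil]
      le_imp_less_Suc[OF bound] by metis
  have gen_e: "gen i = e i" if "P i = 0" for i
    using that p zc_parity[of i] by (cases "zc i = 0") (simp_all add: e_eq smul_algebra)
  have "tword us = eword us"
  proof -
    have "tword vs = eword vs" if "\<forall>i\<in>set vs. P i = 0" for vs
      using that
    proof (induction vs)
      case (Cons i vs)
      then show ?case using gen_e[of i] by (simp add: eword_def tword_Cons[of i vs])
    qed (simp add: eword_def tword_Nil)
    then show ?thesis using us by (simp add: A_def)
  qed
  then have hor: "tword us \<in> horizontal" by (simp add: horizontal_closed)
  have even: "gen i * tword us \<in> ideal" if "P i = 0" for i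
    using max[of "i # us"] that us by (auto simp: A_def tword_Cons[of i us])
  have "Omega * tword us \<in> ideal"
  proof (induction rule: Omega_induct)
    case (quad c k l)
    have "gen k * gen l * tword us \<in> ideal"
    proof (cases "P l = 0")
      case True
      then show ?thesis using even[of l] by (simp only: mult.assoc ideal_closed)
    next
      case False
      then have "P k = 0" using quad p by (cases "P k"; cases "P l") simp_all
      have "gen k * gen l * tword us = rel k l * tword us - smul (koszul k l) (gen l * (gen k * tword us))"
        by (simp only: distrib_right smul_algebra(8) mult.assoc add_diff_cancel)
      then show ?thesis
        by (metis ideal_closed(6) ideal_closed(7) ideal_closed(3)[OF even[OF \<open>P k = 0\<close>]] ideal_closed(4)[OF rel_in_ideal])
    qed
    then show ?case by (simp only: smul_algebra(8) ideal_closed)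
  qed (simp_all add: distrib_right ideal_closed)
  then have "tword us \<in> ideal" by (rule Omega_regular[OF hor])
  then show False using us by (simp add: A_def)
qed

section \<open>Closed forms\<close>

lemma phi_square: "\<phi> * \<phi> \<in> ideal"
proof (rule ideal_half)
  show "\<phi> * \<phi> + \<phi> * \<phi> \<in> ideal"
    using covec_anticommute[OF \<alpha>_gr \<alpha>_gr] by (simp add: center_even sg_def smul_algebra)
qed

lemma e_phi: "e i * \<phi> + \<phi> * e i \<in> ideal"
  using covec_anticommute[OF eps_gr \<alpha>_gr, of i]
  by (simp add: center_even sg_def smul_algebra)

text \<open>
  Split each letter as \<open>gen i = e i + zc i \<phi>\<close> and move \<open>\<phi>\<close> to the front, using that \<open>\<phi>\<close> is even.
\<close>

lemma word_decomposition: "\<exists>a\<in>horizontal. \<exists>g\<in>horizontal. tword u - (a + \<phi> * g) \<in> ideal"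
proof (induction u)
  case Nil
  show ?case
    by (rule bexI[OF _ horizontal_one], rule bexI[OF _ horizontal_closed(1)])
      (simp add: tword_Nil ideal_closed(1))
next
  case (Cons i u)
  then obtain a g where ag: "a \<in> horizontal" "g \<in> horizontal" "tword u - (a + \<phi> * g) \<in> ideal"
    by blast
  have gen: "gen i = e i + smul (zc i) \<phi>" by (simp add: e_eq)
  have "tword (i # u) - (e i * a + \<phi> * (smul (zc i) a - e i * g)) =
      gen i * (tword u - (a + \<phi> * g)) + ((e i * \<phi> + \<phi> * e i) * g + smul (zc i) (\<phi> * \<phi> * g))"
    unfolding tword_Cons[of i u] gen
    by (simp add: algebra_simps mult_smul smul_algebra(8))
  also have "\<dots> \<in> ideal"
    by (intro ideal_closed(2) ideal_closed(7) ideal_closed(4)[OF e_phi] ideal_closed(4)[OF phi_square]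
      ideal_closed(3)[OF ag(3)])
  finally show ?case
    using ag(1,2) by (blast intro: horizontal_mult horizontal_e horizontal_closed(3,4))
qed

lemma decomposition:
  obtains a g where "a \<in> horizontal" "g \<in> horizontal" "t - (a + \<phi> * g) \<in> ideal"
proof -
  have "\<exists>a\<in>horizontal. \<exists>g\<in>horizontal. t - (a + \<phi> * g) \<in> ideal"
  proof (induction t rule: tens_word_induct)
    case zero
    show ?case
      by (rule bexI[OF _ horizontal_closed(1)], rule bexI[OF _ horizontal_closed(1)]) (simp add: ideal_closed(1))
  next
    case (word c u)
    obtain a g where ag: "a \<in> horizontal" "g \<in> horizontal" "tword u - (a + \<phi> * g) \<in> ideal"
      using word_decomposition by blast
    have "smul c (tword u) - (smul c a + \<phi> * smul c g) = smul c (tword u - (a + \<phi> * g))"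
      by (simp add: smul_algebra mult_smul)
    then show ?case
      using ag ideal_closed(7)[OF ag(3), of c] horizontal_closed(4) by metis
  next
    case (add s t)
    then obtain a g b h where ab: "a \<in> horizontal" "g \<in> horizontal" "s - (a + \<phi> * g) \<in> ideal"
      "b \<in> horizontal" "h \<in> horizontal" "t - (b + \<phi> * h) \<in> ideal" by blast
    have "s + t - ((a + b) + \<phi> * (g + h)) = (s - (a + \<phi> * g)) + (t - (b + \<phi> * h))"
      by (simp add: algebra_simps)
    then show ?case
      using ideal_closed(2)[OF ab(3,6)] horizontal_closed(2) ab(1,2,4,5) by metis
  qed
  then show ?thesis using that by blast
qed

text \<open>
  \<open>Omega\<close> is an even form of even degree, so it is central in \<open>\<And>\<gg>\<^sup>*\<close>. Moving \<open>x\<^sub>j\<^sup>*\<close> past two covectors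
  of equal parity yields the same sign twice.
\<close>

lemma Omega_commutes: "Omega * gen j - gen j * Omega \<in> ideal"
proof (induction rule: Omega_induct)
  case zero
  then show ?case by (simp add: ideal_closed(1))
next
  case (add s t)
  have "(s + t) * gen j - gen j * (s + t) = (s * gen j - gen j * s) + (t * gen j - gen j * t)"
    by (simp add: algebra_simps)
  then show ?case using ideal_closed(2)[OF add] by simp
next
  case (quad c k l)
  then have "P k = P l" using center_even by (cases "P k"; cases "P l") simp_all
  then have l: "koszul l j = koszul k j" by (simp add: koszul_def)
  have kk: "koszul k j * koszul k j = 1" by (cases "P k"; cases "P j") (simp_all add: koszul_def sg_def)
  have "smul c (gen k * gen l) * gen j - gen j * smul c (gen k * gen l) =
      smul c (gen k * rel l j - smul (koszul k j) (rel k j * gen l))"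
    unfolding l distrib_left distrib_right mult_smul smul_algebra kk
    by (simp add: mult.assoc)
  also have "\<dots> \<in> ideal"
    by (intro ideal_closed(7) ideal_closed(6) ideal_closed(3)[OF rel_in_ideal] ideal_closed(4)[OF rel_in_ideal])
  finally show ?case .
qed

text \<open>
  A basis vector with a non-zero coordinate of \<open>z\<close> is even, so its Koszul signs are trivial.
\<close>

lemma koszul_zc: "koszul i j * zc i = zc i" "koszul i j * zc j = zc j"
proof -
  show "koszul i j * zc i = zc i"
    using zc_parity[of i] center_even by (cases "zc i = 0") (simp_all add: koszul_def sg_def)
  show "koszul i j * zc j = zc j"
    using zc_parity[of j] center_even by (cases "zc j = 0") (simp_all add: koszul_def sg_def)
qed

lemma ext_diff_rel: "ext_diff L x (rel i j) \<in> ideal"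
proof -
  have gg: "ext_diff L x (gen i * gen j) = smul (zc i) (Omega * gen j) - smul (zc j) (gen i * Omega)" for i j
    using ext_diff_mult[of "gen i" 1 L x "gen j"]
    by (simp add: ext_diff_gen diff_gen_eq mult_smul smul_algebra)
  have "ext_diff L x (rel i j) =
      smul (zc i) (Omega * gen j - gen j * Omega) + smul (zc j) (Omega * gen i - gen i * Omega)"
    unfolding ext_diff_add ext_diff_smul gg smul_algebra(2,4) koszul_zc by simp
  then show ?thesis
    by (simp only: ideal_closed Omega_commutes)
qed

lemma ideal_sign: "t \<in> ideal \<Longrightarrow> (- 1) ^ n * t \<in> ideal"
  by (rule ideal_closed(3))

text \<open>
  The differential is well defined on \<open>\<And>\<gg>\<^sup>*\<close>. For a relation this is the centrality of \<open>Omega\<close>; the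
  Leibniz rule does the rest.
\<close>

lemma ext_diff_ideal:
  assumes "t \<in> ideal"
  shows "ext_diff L x t \<in> ideal"
  using assms
proof (induction rule: ideal_induct)
  case (rel c u i j v)
  have "\<forall>w\<in>Poly_Mapping.keys (rel i j). length (letters w) = 2"
    using smul_rel[of 1 "[]" i j "[]"]
    by (auto simp: smul_algebra tword_Nil in_keys_iff lookup_add lookup_smul lookup_single when_def mult_single plus_word_def split: if_splits)
  then have "ext_diff L x (rel i j * tword v) = ext_diff L x (rel i j) * tword v + rel i j * ext_diff L x (tword v)"
    using ext_diff_mult[of "rel i j" 2 L x "tword v"] by simp
  also have "\<dots> \<in> ideal"
    by (intro ideal_closed(2) ideal_closed(4)[OF ext_diff_rel] ideal_closed(4)[OF rel_in_ideal])
  finally have "ext_diff L x (rel i j * tword v) \<in> ideal" .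
  then have "ext_diff L x (tword u) * (rel i j * tword v) + (- 1) ^ length u * (tword u * ext_diff L x (rel i j * tword v)) \<in> ideal"
    by (intro ideal_closed(2) ideal_sign ideal_closed(3)[of "ext_diff L x _"] ideal_closed(3)[of "rel i j * _"]
      ideal_closed(4)[OF rel_in_ideal])
  moreover have "ext_diff L x (tword u * (rel i j * tword v)) =
      ext_diff L x (tword u) * (rel i j * tword v) + (- 1) ^ length u * (tword u * ext_diff L x (rel i j * tword v))"
    by (rule ext_diff_mult) simp
  ultimately show ?case
    unfolding ext_diff_smul mult.assoc[of "tword u"] by (simp only: ideal_closed(7))
qed (simp_all add: ext_diff_linear ext_diff_add ideal_closed)

lemma ext_diff_decomposed:
  assumes "a \<in> horizontal" "g \<in> horizontal"
  shows "ext_diff L x (a + \<phi> * g) = Omega * g"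
proof -
  have "\<forall>w\<in>Poly_Mapping.keys \<phi>. length (letters w) = 1"
    using keys_covec(1)[OF \<alpha>_gr] by blast
  then have "ext_diff L x (\<phi> * g) = ext_diff L x \<phi> * g - \<phi> * ext_diff L x g"
    using ext_diff_mult[of \<phi> 1 L x g] by simp
  then show ?thesis
    using assms by (simp add: ext_diff_add ext_diff_horizontal ext_diff_covec \<alpha>_dual \<alpha>_z smul_algebra)
qed

text \<open>
  Here the non-degeneracy of \<open>Omega\<close> is used: \<open>d(a + \<phi> \<and> g) = Omega \<and> g\<close> vanishes only
  for \<open>g = 0\<close>.
\<close>

lemma closed_horizontal:
  assumes "ext_diff L x t \<in> ideal"
  shows "t \<in> horizontal_mod"
proof -
  obtain a g where ag: "a \<in> horizontal" "g \<in> horizontal" "t - (a + \<phi> * g) \<in> ideal"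
    by (rule decomposition)
  have "Omega * g = ext_diff L x t - ext_diff L x (t - (a + \<phi> * g))"
    unfolding ext_diff_linear(2) ext_diff_decomposed[OF ag(1,2)] by simp
  then have "Omega * g \<in> ideal"
    using ideal_closed(6)[OF assms ext_diff_ideal[OF ag(3)]] by simp
  then have "g \<in> ideal" by (rule Omega_regular[OF ag(2)])
  moreover have "t - a = (t - (a + \<phi> * g)) + \<phi> * g" by simp
  ultimately have "t - a \<in> ideal"
    using ideal_closed(2)[OF ag(3) ideal_closed(3)] by metis
  then show ?thesis by (rule horizontal_modI[OF ag(1)])
qed

lemma sum_triangle:
  fixes f :: "'i \<Rightarrow> 'i \<Rightarrow> 'a::ab_group_add"
  shows "(\<Sum>l\<in>UNIV. \<Sum>k | k < l. f k l) + (\<Sum>l\<in>UNIV. \<Sum>k | k < l. f l k) =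
    (\<Sum>l\<in>UNIV. \<Sum>k\<in>UNIV. f k l) - (\<Sum>k\<in>UNIV. f k k)"
proof -
  have "(\<Sum>k\<in>UNIV. f k l) = (\<Sum>k | k < l. f k l) + (\<Sum>k | l < k. f k l) + f l l" for l
  proof -
    have "(UNIV :: 'i set) = {k. k < l} \<union> {k. l < k} \<union> {l}" by auto
    then have "(\<Sum>k\<in>UNIV. f k l) = (\<Sum>k\<in>{k. k < l} \<union> {k. l < k} \<union> {l}. f k l)" by simp
    also have "\<dots> = (\<Sum>k\<in>{k. k < l} \<union> {k. l < k}. f k l) + (\<Sum>k\<in>{l}. f k l)"
      by (rule sum.union_disjoint) auto
    also have "(\<Sum>k\<in>{k. k < l} \<union> {k. l < k}. f k l) = (\<Sum>k | k < l. f k l) + (\<Sum>k | l < k. f k l)"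
      by (rule sum.union_disjoint) auto
    finally show ?thesis by simp
  qed
  moreover have "(\<Sum>l\<in>UNIV. \<Sum>k | l < k. f k l) = (\<Sum>l\<in>UNIV. \<Sum>k | k < l. f l k)"
    using sum.swap_restrict[of UNIV UNIV "\<lambda>l k. f k l" "\<lambda>l k. l < k"] by simp
  ultimately show ?thesis by (simp add: sum.distrib)
qed

lemma \<omega>_center:
  "(\<Sum>k\<in>UNIV. \<omega> (x k) u * zc k) = 0" "(\<Sum>k\<in>UNIV. \<omega> u (x k) * zc k) = 0"
proof -
  have "\<omega> (\<Sum>k\<in>UNIV. scl L (zc k) (x k)) u = 0" "\<omega> u (\<Sum>k\<in>UNIV. scl L (zc k) (x k)) = 0"
    unfolding sum_coord central by (rule \<alpha>_lin(3))+
  then show "(\<Sum>k\<in>UNIV. \<omega> (x k) u * zc k) = 0" "(\<Sum>k\<in>UNIV. \<omega> u (x k) * zc k) = 0"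
    by (simp_all add: brk_sum brk_linear \<alpha>_lin mult.commute)
qed

lemma \<omega>_swap: "\<omega> (x k) (x l) = - koszul k l * \<omega> (x l) (x k)"
proof -
  have "\<alpha> (- u) = - \<alpha> u" for u using \<alpha>_lin(4)[of 0 u] \<alpha>_lin(3) by simp
  then show ?thesis by (subst brk_basis_swap) (simp add: \<alpha>_lin(2))
qed

lemma koszul_sym: "koszul k l = koszul l k"
  by (simp add: koszul_def mult.commute)

text \<open>
  Substitute \<open>gen i = e i + zc i \<phi>\<close> in \<open>Omega\<close>. The part with the factor \<open>\<phi>\<close> is, by the
  supersymmetry of \<open>\<omega>\<close>, a sum of terms \<open>\<omega>(z, x\<^sub>l) e l\<close>, and \<open>z\<close> is central.
\<close>

lemma Omega_horizontal: "Omega \<in> horizontal_mod"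
proof -
  define X where "X k l = smul (zc k) (e l) - smul (zc l) (e k)" for k l
  \<comment> \<open>The part of \<open>Omega\<close> with the factor \<open>\<phi>\<close>; the diagonal terms contribute nothing, as \<open>X k k = 0\<close>.\<close>
  define B where "B = (\<Sum>l\<in>UNIV. \<Sum>k | k < l. smul (- koszul k l * \<omega> (x k) (x l)) (X k l))"
  \<comment> \<open>The sum of \<open>Y k l\<close> over all \<open>k\<close> is \<open>\<omega>(z, x\<^sub>l) e l = 0\<close>.\<close>
  define Y where "Y k l = smul (\<omega> (x k) (x l) * zc k) (e l)" for k l
  have XY: "smul (- koszul k l * \<omega> (x k) (x l)) (X k l) = - (Y k l + Y l k)" for k l
  proof -
    have "- koszul k l * \<omega> (x k) (x l) * zc k = - (\<omega> (x k) (x l) * zc k)"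
      by (subst (2) koszul_zc(1)[of k l, symmetric]) simp
    moreover have "- koszul k l * \<omega> (x k) (x l) * zc l = \<omega> (x l) (x k) * zc l"
      by (simp add: \<omega>_swap[of l k] koszul_sym[of l k])
    ultimately show ?thesis
      by (simp add: X_def Y_def smul_algebra)
  qed
  have "Y k k = 0" for k
  proof -
    have "\<omega> (x k) (x k) * zc k = - (\<omega> (x k) (x k) * (koszul k k * zc k))"
      by (subst \<omega>_swap) (simp add: ac_simps)
    then have "\<omega> (x k) (x k) * zc k = 0"
      unfolding koszul_zc by auto
    then show ?thesis by (simp add: Y_def smul_algebra)
  qed
  moreover have "(\<Sum>k\<in>UNIV. Y k l) = 0" for l
    by (simp add: Y_def sum_smul[symmetric] \<omega>_center smul_algebra)
  ultimately have "B = 0"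
    using sum_triangle[of Y] unfolding B_def XY sum_negf sum.distrib by simp
  have quad: "gen k * gen l - \<phi> * X k l \<in> horizontal_mod" for k l
  proof (rule horizontal_modI)
    show "e k * e l \<in> horizontal" by (intro horizontal_mult horizontal_e)
    have gen: "gen i = e i + smul (zc i) \<phi>" for i by (simp add: e_eq)
    have "gen k * gen l - \<phi> * X k l - e k * e l =
        smul (zc l) (e k * \<phi> + \<phi> * e k) + smul (zc k * zc l) (\<phi> * \<phi>)"
      unfolding gen X_def by (simp add: algebra_simps mult_smul smul_algebra)
    then show "gen k * gen l - \<phi> * X k l - e k * e l \<in> ideal"
      by (simp only: ideal_closed e_phi phi_square)
  qed
  have "Omega = Omega - \<phi> * B"
    by (simp add: \<open>B = 0\<close>)
  also have "\<dots> = (\<Sum>l\<in>UNIV. \<Sum>k | k < l. smul (- koszul k l * \<omega> (x k) (x l)) (gen k * gen l - \<phi> * X k l)) +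
      smul (1 / 2) (\<Sum>k\<in>UNIV. smul (\<omega> (x k) (x k)) (gen k * gen k - \<phi> * X k k))"
    unfolding Omega_def B_def sum_distrib_left mult_smul smul_algebra(2) sum_subtractf by (simp add: X_def)
  also have "\<dots> \<in> horizontal_mod"
    by (intro horizontal_mod_closed(3) horizontal_mod_closed(5) horizontal_mod_sum quad)
  finally show ?thesis .
qed

text \<open>
  \<open>d(a + \<phi> \<and> g) = Omega \<and> g\<close> is horizontal since \<open>Omega\<close> is.
\<close>

lemma exact_horizontal: "ext_diff L x t \<in> horizontal_mod"
proof -
  obtain a g where ag: "a \<in> horizontal" "g \<in> horizontal" "t - (a + \<phi> * g) \<in> ideal"
    by (rule decomposition)
  have "ext_diff L x t = Omega * g + ext_diff L x (t - (a + \<phi> * g))"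
    unfolding ext_diff_linear(2) ext_diff_decomposed[OF ag(1,2)] by simp
  also have "\<dots> \<in> horizontal_mod"
    by (intro horizontal_mod_closed(3) horizontal_mod_closed(4)[OF Omega_horizontal]
      horizontal_mod_closed(1)[OF ag(2)] horizontal_mod_closed(2)[OF ext_diff_ideal[OF ag(3)]])
  finally show ?thesis .
qed

section \<open>Cochains\<close>

text \<open>
  The image of a cochain under the projection of \<open>\<gg>\<close> that kills \<open>z\<close> and whose coordinates are
  the functionals \<open>eps i\<close>.
\<close>

definition horizontal_cochain :: "('i, 'k) cochain \<Rightarrow> ('i, 'k) cochain" where
  "horizontal_cochain F i = (\<Sum>j\<in>UNIV. smul (eps i (x j)) (F j))"

definition vertical_component :: "('i, 'k) cochain \<Rightarrow> ('i, 'k) tens" where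
  "vertical_component F = (\<Sum>j\<in>UNIV. smul (\<alpha> (x j)) (F j))"

lemma cochain_split: "F i = horizontal_cochain F i + smul (zc i) (vertical_component F)"
proof -
  have "smul (eps i (x j)) (F j) + smul (zc i) (smul (\<alpha> (x j)) (F j)) = (if i = j then F j else 0)" for j
    by (simp add: eps_def coord_linear smul_algebra tens.scale_left_diff_distrib)
  then show ?thesis
    by (simp add: horizontal_cochain_def vertical_component_def smul_sum sum.distrib[symmetric])
qed

text \<open>
  All brackets are multiples of \<open>z\<close>, so modulo \<open>z\<close> only the differential of the coefficients survives.
\<close>

lemma horizontal_cochain_diff:
  "horizontal_cochain (cochain_diff L x F) i = ext_diff L x (horizontal_cochain F i)"
proof -
  define T where "T = (\<Sum>i\<in>UNIV. \<Sum>j\<in>UNIV. smul (\<omega> (x j) (x i) * koszul j i) (gen j * F i))"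
  have "cochain_diff L x F m = smul (zc m) T + ext_diff L x (F m)" for m
    by (simp add: cochain_diff_apply T_def coord_brk smul_sum smul_algebra(4) ac_simps)
  then have "horizontal_cochain (cochain_diff L x F) i =
      smul (\<Sum>m\<in>UNIV. zc m * eps i (x m)) T + ext_diff L x (horizontal_cochain F i)"
    by (simp add: horizontal_cochain_def ext_diff_sum ext_diff_smul sum_smul smul_algebra sum.distrib mult.commute)
  then show ?thesis
    by (simp add: dual_expand[OF eps_dual, symmetric] eps_z smul_algebra)
qed

text \<open>
  The two properties of a cocycle on which the argument relies. Coboundaries and cochains
  that vanish in \<open>\<gg> \<otimes> \<And>\<gg>\<^sup>*\<close> have them too, so they hold for every representative of a class.
\<close>

definition admissible :: "('i, 'k) cochain \<Rightarrow> bool" where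
  "admissible F \<longleftrightarrow>
     (\<forall>i. horizontal_cochain F i \<in> horizontal_mod) \<and> (\<forall>u. brk L (constant_part F) u = 0)"

lemma admissible_add: "admissible F \<Longrightarrow> admissible H \<Longrightarrow> admissible (F + H)"
  unfolding admissible_def
  by (simp add: horizontal_cochain_def constant_part_def smul_algebra sum.distrib lookup_add
    vs.scale_left_distrib brk_linear horizontal_mod_closed(3))

lemma admissible_null:
  assumes "N \<in> null_cochains L x"
  shows "admissible N"
proof -
  have N: "N i \<in> ideal" for i using assms by (simp add: null_cochains_def)
  have "horizontal_cochain N i \<in> ideal" for i
    unfolding horizontal_cochain_def by (intro ideal_sum ideal_closed(7) N)
  moreover have "constant_part N = 0"
    using ideal_low_degree[OF N, of 0] by (simp add: constant_part_def zero_word_def)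
  ultimately show ?thesis
    by (simp add: admissible_def horizontal_mod_closed(2) brk_linear)
qed

text \<open>
  The coefficients modulo \<open>z\<close> are closed forms; the constant part is central since the degree \<open>1\<close>
  component of the differential is the bracket with it.
\<close>

lemma admissible_cocycle:
  assumes "F \<in> cocycles L x"
  shows "admissible F"
proof -
  have null: "cochain_diff L x F i \<in> ideal" for i
    using assms by (simp add: cocycles_def null_cochains_def)
  have "ext_diff L x (horizontal_cochain F i) \<in> ideal" for i
    unfolding horizontal_cochain_diff[symmetric]
    unfolding horizontal_cochain_def[of "cochain_diff L x F"]
    by (intro ideal_sum ideal_closed(7) null)
  moreover have "brk L (constant_part F) (x k) = 0" for k
  proof (rule vec_eqI)
    show "coord L x (brk L (constant_part F) (x k)) i = coord L x 0 i" for i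
      using lookup_cochain_diff[of F i k] ideal_low_degree[OF null, of "Word [k]" i] by (simp add: coord_linear)
  qed
  then have "brk L (constant_part F) (\<Sum>k\<in>UNIV. scl L (a k) (x k)) = 0" for a
    by (simp add: brk_sum brk_linear)
  then have "brk L (constant_part F) u = 0" for u
    by (metis sum_coord)
  ultimately show ?thesis
    by (simp add: admissible_def closed_horizontal)
qed

lemma admissible_exact: "admissible (cochain_diff L x F)"
proof -
  have "Poly_Mapping.lookup (cochain_diff L x F i) 0 = 0" for i
  proof -
    have "Poly_Mapping.lookup (gen j * t) 0 = 0" for j and t :: "('i, 'k) tens"
      by (induction t rule: tens_word_induct)
        (simp_all add: mult_smul lookup_smul mult_single plus_word_def lookup_single when_def zero_word_def distrib_left lookup_add)
    then show ?thesis
      using ext_diff_low_degree[of 0]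
      by (simp add: cochain_diff_apply lookup_add lookup_sum lookup_smul zero_word_def)
  qed
  then have "constant_part (cochain_diff L x F) = 0"
    by (simp add: constant_part_def)
  then show ?thesis
    by (simp add: admissible_def horizontal_cochain_diff exact_horizontal brk_linear)
qed

lemma admissible_coboundary: "F \<in> coboundaries L x \<Longrightarrow> admissible F"
  unfolding coboundaries_def
  by (elim set_plus_elim rangeE) (simp add: admissible_add admissible_exact admissible_null)

section \<open>The cup product\<close>

text \<open>
  The coefficient of \<open>z\<close> in the cup product.
\<close>

definition pairing :: "('i, 'k) cochain \<Rightarrow> ('i, 'k) cochain \<Rightarrow> ('i, 'k) tens" where
  "pairing F H = (\<Sum>i\<in>UNIV. \<Sum>j\<in>UNIV. \<Sum>q\<in>{0, 1}.
     smul (\<omega> (x i) (x j) * sg (q * P j)) (par_part L x q (F i) * H j))"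

lemma cup_pairing: "cup L x F H = tensor L x z (pairing F H)"
  by (rule ext) (simp only: cup_def pairing_def fun_sum_apply sg_mult_smul tensor_def coord_brk
    smul_sum smul_algebra(4) ac_simps)

lemma par_part_algebra:
  "par_part L x q (s + t) = par_part L x q s + par_part L x q t"
  "par_part L x q (smul c s) = smul c (par_part L x q s)"
  for s t :: "('i, 'k) tens"
  by (simp_all add: par_part_eq_part part_algebra)

lemma pairing_add:
  "pairing (\<lambda>i. F i + F' i) H = pairing F H + pairing F' H"
  "pairing F (\<lambda>i. H i + H' i) = pairing F H + pairing F H'"
  by (simp_all only: pairing_def par_part_algebra distrib_left distrib_right smul_algebra(1) sum.distrib)

text \<open>
  The components along \<open>z\<close> contribute \<open>\<omega>(z, x\<^sub>j)\<close> and \<open>\<omega>(x\<^sub>i, z)\<close>. For the second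
  statement, the Koszul sign is constant because \<open>z\<close> is even.
\<close>

lemma pairing_central:
  "pairing (\<lambda>i. smul (zc i) A) H = 0" "pairing F (\<lambda>j. smul (zc j) B) = 0"
proof -
  have "pairing (\<lambda>i. smul (zc i) A) H = (\<Sum>j\<in>UNIV. \<Sum>i\<in>UNIV. \<Sum>q\<in>{0, 1}.
      smul (\<omega> (x i) (x j) * zc i) (smul (sg (q * P j)) (par_part L x q A * H j)))"
    unfolding pairing_def par_part_algebra smul_algebra(4,8)
    by (subst sum.swap) (simp only: ac_simps)
  also have "\<dots> = (\<Sum>j\<in>UNIV. smul (\<Sum>i\<in>UNIV. \<omega> (x i) (x j) * zc i) (\<Sum>q\<in>{0, 1}. smul (sg (q * P j)) (par_part L x q A * H j)))"
    unfolding smul_sum[symmetric] sum_smul ..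
  finally show "pairing (\<lambda>i. smul (zc i) A) H = 0"
    by (simp only: \<omega>_center smul_algebra(6) sum.neutral_const)
next
  have sg: "sg (q * P j) * zc j = zc j" for q j
    using zc_parity[of j] center_even by (cases "zc j = 0") (simp_all add: sg_def)
  have "pairing F (\<lambda>j. smul (zc j) B) = (\<Sum>i\<in>UNIV. \<Sum>j\<in>UNIV. \<Sum>q\<in>{0, 1}.
      smul (\<omega> (x i) (x j) * zc j) (par_part L x q (F i) * B))"
    unfolding pairing_def mult_smul smul_algebra(4) mult.assoc sg ..
  also have "\<dots> = (\<Sum>i\<in>UNIV. smul (\<Sum>j\<in>UNIV. \<omega> (x i) (x j) * zc j) (\<Sum>q\<in>{0, 1}. par_part L x q (F i) * B))"
    unfolding smul_sum[symmetric] sum_smul ..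
  finally show "pairing F (\<lambda>j. smul (zc j) B) = 0"
    by (simp only: \<omega>_center smul_algebra(6) sum.neutral_const)
qed

lemma pairing_horizontal: "pairing F H = pairing (horizontal_cochain F) (horizontal_cochain H)"
proof -
  have "pairing F H = pairing (\<lambda>i. horizontal_cochain F i + smul (zc i) (vertical_component F))
      (\<lambda>j. horizontal_cochain H j + smul (zc j) (vertical_component H))"
    unfolding cochain_split[symmetric] ..
  then show ?thesis
    by (simp only: pairing_add pairing_central add_0_right)
qed

lemma pairing_admissible:
  assumes "admissible F" "admissible H"
  shows "pairing F H \<in> horizontal_mod"
  unfolding pairing_horizontal[of F H] unfolding pairing_def par_part_eq_part
  by (intro horizontal_mod_sum horizontal_mod_closed(5) horizontal_mod_closed(4) horizontal_mod_closed(6)[where R = "\<lambda>_ r. r = _"])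
    (use assms in \<open>simp_all add: admissible_def\<close>)

lemma lookup_mult_0:
  "Poly_Mapping.lookup (s * t) 0 = Poly_Mapping.lookup s 0 * Poly_Mapping.lookup t 0"
  for s t :: "('i, 'k) tens"
proof (induction s rule: tens_word_induct)
  case (word c u)
  show ?case
  proof (induction t rule: tens_word_induct)
    case (word d v)
    then show ?case
      by (simp add: mult_smul smul_algebra lookup_smul mult_single plus_word_def lookup_single when_def zero_word_def)
  qed (simp_all add: distrib_left lookup_add)
qed (simp_all add: distrib_right lookup_add)

text \<open>
  In degree \<open>0\<close> the cup product is the bracket.
\<close>

lemma lookup_pairing:
  "Poly_Mapping.lookup (pairing F H) 0 = \<omega> (constant_part F) (constant_part H)"
proof -
  have par: "Poly_Mapping.lookup (par_part L x q t) 0 = (if q = 0 then Poly_Mapping.lookup t 0 else 0)" for q t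
    by (cases q) (simp_all add: par_part_eq_part lookup_part par_word_def zero_word_def)
  have "Poly_Mapping.lookup (\<Sum>q\<in>{0, 1}. smul (c * sg (q * P j)) (par_part L x q s * t)) 0 =
      Poly_Mapping.lookup s 0 * (Poly_Mapping.lookup t 0 * c)" for c j s t
    by (simp add: lookup_add lookup_smul lookup_mult_0 par sg_def)
  then show ?thesis
    by (simp add: pairing_def lookup_sum constant_part_def brk_sum brk_linear \<alpha>_lin sum_distrib_left
      del: sum.insert) (subst sum.swap, simp add: mult.left_commute)
qed

lemma cochain_diff_minus: "cochain_diff L x (F - H) = cochain_diff L x F - cochain_diff L x H"
  by (rule ext) (simp add: cochain_diff_apply right_diff_distrib smul_algebra sum_subtractf ext_diff_linear)

lemma coboundaries_diff:
  assumes "F \<in> coboundaries L x" "H \<in> coboundaries L x"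
  shows "F - H \<in> coboundaries L x"
proof -
  obtain F' M H' N where eq: "F = cochain_diff L x F' + M" "H = cochain_diff L x H' + N"
    and MN: "M \<in> null_cochains L x" "N \<in> null_cochains L x"
    using assms unfolding coboundaries_def by (auto simp: set_plus_def)
  have "F - H = cochain_diff L x (F' - H') + (M - N)"
    by (simp add: eq cochain_diff_minus)
  moreover have "M - N \<in> null_cochains L x"
    using MN by (simp add: null_cochains_def ideal_closed)
  ultimately show ?thesis
    unfolding coboundaries_def by (auto intro: set_plus_intro)
qed

lemma null_coboundary: "N \<in> null_cochains L x \<Longrightarrow> N \<in> coboundaries L x"
proof -
  assume "N \<in> null_cochains L x"
  moreover have "cochain_diff L x 0 = 0"
    using cochain_diff_minus[of 0 0] by simp
  then have "0 \<in> range (cochain_diff L x)" by (metis rangeI)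
  ultimately show ?thesis
    unfolding coboundaries_def using set_plus_intro[of 0 _ N] by simp
qed

lemma coboundaries_zero: "0 \<in> coboundaries L x"
  by (rule null_coboundary) (simp add: null_cochains_def ideal_closed(1))

lemma coboundaries_add: "F \<in> coboundaries L x \<Longrightarrow> H \<in> coboundaries L x \<Longrightarrow> F + H \<in> coboundaries L x"
  using coboundaries_diff[OF _ coboundaries_diff[OF coboundaries_zero], of F H] by simp

lemma coboundaries_sum: "(\<And>k. k \<in> A \<Longrightarrow> f k \<in> coboundaries L x) \<Longrightarrow> (\<Sum>k\<in>A. f k) \<in> coboundaries L x"
  by (induction A rule: infinite_finite_induct) (simp_all add: coboundaries_zero coboundaries_add)

lemma coboundaries_coset:
  assumes "F \<in> coboundaries L x"
  shows "F +o coboundaries L x = coboundaries L x"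
proof
  show "F +o coboundaries L x \<subseteq> coboundaries L x"
    using coboundaries_add[OF assms] by (auto simp: elt_set_plus_def)
  show "coboundaries L x \<subseteq> F +o coboundaries L x"
  proof
    fix H assume "H \<in> coboundaries L x"
    then show "H \<in> F +o coboundaries L x"
      using set_plus_intro2[OF coboundaries_diff[OF _ assms], of H F] by simp
  qed
qed

text \<open>
  Condition (1), summed over the homogeneous components of positive degree.
\<close>

lemma central_coboundary:
  assumes cob: "\<And>k. k \<ge> 1 \<Longrightarrow> tensor_space L x (derived L) (ext_power x (annihilator L (derived L)) k) \<subseteq> coboundaries L x"
    and t: "t \<in> horizontal_mod" "Poly_Mapping.lookup t 0 = 0"
  shows "tensor L x z t \<in> coboundaries L x"
proof -
  obtain a where a: "a \<in> horizontal" "t - a \<in> ideal"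
    using t(1) by (auto simp: horizontal_mod_def)
  have "Poly_Mapping.lookup (t - a) 0 = 0"
    by (rule ideal_low_degree[OF a(2)]) (simp add: zero_word_def)
  then have a0: "Poly_Mapping.lookup a 0 = 0"
    using t(2) by (simp add: lookup_minus)
  obtain N where N: "a = (\<Sum>k\<le>N. len_part k a)"
    by (rule len_part_decomposition)
  have parts: "tensor L x z (len_part k a) \<in> coboundaries L x" for k
  proof (cases "k = 0")
    case True
    then have "len_part k a = 0"
      by (simp only: True len_part_0 a0 smul_algebra(6))
    then show ?thesis by (simp only: tensor_linear coboundaries_zero)
  next
    case False
    then show ?thesis
      using cob[of k] tensor_mem_space[OF z_derived len_part_horizontal[OF a(1), of k, unfolded horizontal_dual_def]]
      by auto
  qed
  have tensor_sum_right: "tensor L x z (\<Sum>k\<in>A. f k) = (\<Sum>k\<in>A. tensor L x z (f k))" for A and f :: "nat \<Rightarrow> ('i, 'k) tens"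
    by (induction A rule: infinite_finite_induct) (simp_all add: tensor_linear)
  have "tensor L x z a \<in> coboundaries L x"
    by (subst N) (simp only: tensor_sum_right coboundaries_sum parts)
  moreover have "tensor L x z (t - a) \<in> coboundaries L x"
    by (rule null_coboundary) (simp add: null_cochains_def tensor_def ideal_closed(7)[OF a(2)])
  moreover have "tensor L x z t = tensor L x z a + tensor L x z (t - a)"
    by (simp add: tensor_linear(2)[symmetric])
  ultimately show ?thesis by (simp add: coboundaries_add)
qed

lemma cup_trivial:
  assumes cob: "\<And>k. k \<ge> 1 \<Longrightarrow> tensor_space L x (derived L) (ext_power x (annihilator L (derived L)) k) \<subseteq> coboundaries L x"
    and A: "A \<in> cohomology L x" and B: "B \<in> cohomology L x"
  shows "cup_class L x A B = coboundaries L x"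
proof -
  have adm: "admissible F" if C: "C \<in> cohomology L x" and F: "F \<in> C" for C F
  proof -
    obtain F' where F': "C = F' +o coboundaries L x" "F' \<in> cocycles L x"
      using C unfolding cohomology_def by blast
    obtain G where "F = F' + G" "G \<in> coboundaries L x"
      using F unfolding F' elt_set_plus_def by blast
    with F'(2) show ?thesis by (simp add: admissible_add admissible_cocycle admissible_coboundary)
  qed
  have "cup L x F H \<in> coboundaries L x" if "F \<in> A" "H \<in> B" for F H
  proof -
    note F = adm[OF A \<open>F \<in> A\<close>] and H = adm[OF B \<open>H \<in> B\<close>]
    have "Poly_Mapping.lookup (pairing F H) 0 = 0"
      using F by (simp add: lookup_pairing admissible_def \<alpha>_lin)
    then show ?thesis
      unfolding cup_pairing by (intro central_coboundary cob pairing_admissible F H)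
  qed
  then have cosets: "cup L x F H +o coboundaries L x = coboundaries L x" if "F \<in> A" "H \<in> B" for F H
    using that coboundaries_coset by blast
  have "C \<noteq> {}" if "C \<in> cohomology L x" for C
    using that coboundaries_zero by (auto simp: cohomology_def elt_set_plus_def)
  then obtain F H where "F \<in> A" "H \<in> B"
    using A B by blast
  then show ?thesis
    unfolding cup_class_def using cosets by auto
qed

end

theorem theorem3:
  fixes L :: "('k::{alg_closed_field, field_char_0}, 'g::ab_group_add) superalg"
    and x :: "'i::{finite, linorder} \<Rightarrow> 'g"
    and V :: "'g set"
  assumes "lie_superalgebra L"
    and "finite_dim L"
    and "two_step_nilpotent L"
    and "homogeneous_basis L x"
    and "graded_complement L (derived L) V"
    and "\<And>k. k \<ge> 1 \<Longrightarrow>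
      tensor_space L x (derived L) (ext_power x (annihilator L (derived L)) k) \<subseteq> coboundaries L x"
    and "\<And>k f g. k \<ge> 1 \<Longrightarrow> f \<in> annihilator L V \<Longrightarrow>
      g \<in> ext_power x (annihilator L (derived L)) k \<Longrightarrow>
      ext_diff L x (covec x f) * g \<in> ext_ideal L x \<Longrightarrow> f = 0 \<or> g \<in> ext_ideal L x"
  shows "\<forall>A \<in> cohomology L x. \<forall>B \<in> cohomology L x. cup_class L x A B = coboundaries L x"
proof -
  interpret based_superalgebra L x
    using assms(1,4) by (simp add: based_superalgebra_def based_superalgebra_axioms_def)
  obtain z p \<alpha> where line: "z \<in> gr L p" "\<alpha> \<in> dual_gr L p" "\<alpha> z = 1"
    "\<And>u v. brk L u v = scl L (\<alpha> (brk L u v)) z"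
    "\<And>u. brk L z u = 0" "\<And>u. brk L u z = 0" "z \<in> derived L"
    using derived_line[OF assms(3) assms(6)[of 1]] by blast
  interpret line_superalgebra L x z p \<alpha>
    by unfold_locales (fact line)+
  have "z \<noteq> 0" using line(3) \<alpha>_lin(3) by auto
  then have "z \<notin> V"
    using assms(5) line(7) unfolding graded_complement_def by blast
  moreover have "vs.subspace V"
    using assms(5) by (simp add: graded_complement_def)
  ultimately obtain f where f: "f \<in> annihilator L V" "f z = 1"
    using separate by blast
  have "f \<noteq> 0" using f(2) by auto
  have "ext_diff L x (covec x f) = Omega"
    using f by (subst ext_diff_covec) (simp_all add: annihilator_def smul_algebra)
  then interpret regular_superalgebra L x z p \<alpha>
    using assms(7)[OF _ f(1)] \<open>f \<noteq> 0\<close> by unfold_locales (auto simp: horizontal_dual_def)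
  show ?thesis
    using cup_trivial[OF assms(6)] by blast
qed

end
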